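(* Let $\mathbf{T}(f)$ be a symmetric tridiagonal $k$-Toeplitz operator with symbol $f$. A number $\lambda\in\mathbb{C}$ is an edge eigenvalue of $\mathbf{T}(f)$ if and only if $\lambda\in G_0\cap\sigma(\mathbf{B}_0)$.
   Context: Let $k\ge 1$, $a_1,\dots,a_k\in\mathbb{C}$ and $b_1,\dots,b_k\in\mathbb{C}\setminus\{0\}$, extended $k$-periodically in the index. The symmetric (not necessarily Hermitian) tridiagonal $k$-Toeplitz operator $\mathbf{T}(f)$ on $\ell^2(\mathbb{N})$, $\mathbb{N}=\{1,2,\dots\}$, has matrix entries $\mathbf{T}(f)_{n,n}=a_n$, $\mathbf{T}(f)_{n,n+1}=\mathbf{T}(f)_{n+1,n}=b_n$, and all other entries zero. Its symbol is $f(z)=\mathbf{A}_{-1}z^{-1}+\mathbf{A}_0+\mathbf{A}_1z\in\mathbb{C}^{k\times k}$, $z\in\mathbb{C}\setminus\{0\}$, where $\mathbf{A}_0$ is the leading $k\times k$ block of $\mathbf{T}(f)$, $\mathbf{A}_{-1}$ has the single nonzero entry $b_k$ in position $(k,1)$, and $\mathbf{A}_1$ has the single nonzero entry $b_k$ in position $(1,k)$. $\mathbf{B}_0$ is the leading $(k-1)\times(k-1)$ principal submatrix of $\mathbf{A}_0$ (with $\sigma(\mathbf{B}_0)=\emptyset$ if $k=1$). For a continuous matrix function $g:\mathbb{T}\to\mathbb{C}^{k\times k}$ on the unit circle $\mathbb{T}$ with Fourier coefficients $g_n$ (so $g(z)=\sum_n g_nz^n$), $\mathbf{T}(g)$ denotes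 the semi-infinite block Toeplitz operator with $(i,j)$ block $g_{i-j}$. For $\lambda\in\mathbb{C}$ let $z_1(\lambda),z_2(\lambda)$ be the two roots of the quadratic polynomial $z\det(f(z)-\lambda\,\mathrm{Id})$ in $z$; $\Gamma=\{\lambda\in\mathbb{C}:|z_1(\lambda)|=|z_2(\lambda)|\}$. For $\lambda\in\mathbb{C}\setminus\Gamma$ set $$C_0(\lambda)=\det\Big(\mathbf{T}\big((f-\lambda\,\mathrm{Id})^{-1}\big)\,\mathbf{T}(f-\lambda\,\mathrm{Id})\Big)$$ (a Fredholm determinant of identity plus a trace-class operator), and $G_0=\{\lambda\in\mathbb{C}\setminus\Gamma:C_0(\lambda)=0\}$. $\sigma_{\mathrm{ess}}$ denotes the essential spectrum (the set of $\lambda$ for which the operator minus $\lambda$ is not Fredholm). A number $\lambda\in\mathbb{C}\setminus\sigma_{\mathrm{ess}}(\mathbf{T}(f))$ is an edge eigenvalue of $\mathbf{T}(f)$ if there is $\mathbf{v}\in\ell^2(\mathbb{N})\setminus\{0\}$, with $|\mathbf{v}_n|$ decaying exponentially as $n\to\infty$, such that $\mathbf{T}(f)\mathbf{v}=\lambda\mathbf{v}$. *)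

theory Defs
  imports
    "HOL-Analysis.Analysis"
    "Jordan_Normal_Form.Spectral_Radius"
    "Jordan_Normal_Form.Gauss_Jordan_Elimination"
begin

(* All indices are shifted to start at 0: "x n", "a n", "b n" stand for x_{n+1}, a_{n+1}, b_{n+1};
   of a and b only the values at indices below k are used, the periodic extension being built
   into tridiag. Operators on l^2 are functions on sequences; their values outside ell2 are
   irrelevant. *)

definition ell2 :: "(nat \<Rightarrow> complex) set" where
  "ell2 = {x. summable (\<lambda>n. (norm (x n))\<^sup>2)}"

definition ell2_norm :: "(nat \<Rightarrow> complex) \<Rightarrow> real" where
  "ell2_norm x = sqrt (\<Sum>n. (norm (x n))\<^sup>2)"

definition op_of :: "(nat \<Rightarrow> nat \<Rightarrow> complex) \<Rightarrow> (nat \<Rightarrow> complex) \<Rightarrow> (nat \<Rightarrow> complex)" where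
  "op_of M x = (\<lambda>n. \<Sum>m. M n m * x m)"

definition unit_seq :: "nat \<Rightarrow> nat \<Rightarrow> complex" where
  "unit_seq j = (\<lambda>i. if i = j then 1 else 0)"

definition entry :: "((nat \<Rightarrow> complex) \<Rightarrow> (nat \<Rightarrow> complex)) \<Rightarrow> nat \<Rightarrow> nat \<Rightarrow> complex" where
  "entry A i j = A (unit_seq j) i"

definition op_minus_scalar ::
    "((nat \<Rightarrow> complex) \<Rightarrow> (nat \<Rightarrow> complex)) \<Rightarrow> complex \<Rightarrow> (nat \<Rightarrow> complex) \<Rightarrow> (nat \<Rightarrow> complex)" where
  "op_minus_scalar A lam x = (\<lambda>n. A x n - lam * x n)"

definition lin_span :: "(nat \<Rightarrow> complex) set \<Rightarrow> (nat \<Rightarrow> complex) set" where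
  "lin_span B = {(\<lambda>n. \<Sum>v\<in>F. c v * v n) | F c. finite F \<and> F \<subseteq> B}"

definition op_kernel :: "((nat \<Rightarrow> complex) \<Rightarrow> (nat \<Rightarrow> complex)) \<Rightarrow> (nat \<Rightarrow> complex) set" where
  "op_kernel A = {x \<in> ell2. A x = (\<lambda>n. 0)}"

definition closed_in_ell2 :: "(nat \<Rightarrow> complex) set \<Rightarrow> bool" where
  "closed_in_ell2 S \<longleftrightarrow> (\<forall>X. \<forall>y\<in>ell2. (\<forall>j. X j \<in> S) \<and>
     (\<lambda>j. ell2_norm (\<lambda>n. X j n - y n)) \<longlonglongrightarrow> 0 \<longrightarrow> y \<in> S)"

(* Meant for bounded A mapping ell2 to ell2; the span of a finite set C being all of ell2 modulo
   the range of A says that the cokernel is finite-dimensional. *)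
definition fredholm :: "((nat \<Rightarrow> complex) \<Rightarrow> (nat \<Rightarrow> complex)) \<Rightarrow> bool" where
  "fredholm A \<longleftrightarrow>
     (\<exists>B. finite B \<and> B \<subseteq> ell2 \<and> op_kernel A \<subseteq> lin_span B) \<and>
     closed_in_ell2 (A ` ell2) \<and>
     (\<exists>C. finite C \<and> C \<subseteq> ell2 \<and> (\<forall>y\<in>ell2. \<exists>x\<in>ell2. \<exists>w\<in>lin_span C. y = (\<lambda>n. A x n + w n)))"

definition ess_spectrum :: "((nat \<Rightarrow> complex) \<Rightarrow> (nat \<Rightarrow> complex)) \<Rightarrow> complex set" where
  "ess_spectrum A = {lam. \<not> fredholm (op_minus_scalar A lam)}"

definition exp_decaying :: "(nat \<Rightarrow> complex) \<Rightarrow> bool" where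
  "exp_decaying v \<longleftrightarrow> (\<exists>C q :: real. 0 < q \<and> q < 1 \<and> (\<forall>n. norm (v n) \<le> C * q ^ n))"

definition edge_eigenvalue :: "((nat \<Rightarrow> complex) \<Rightarrow> (nat \<Rightarrow> complex)) \<Rightarrow> complex \<Rightarrow> bool" where
  "edge_eigenvalue A lam \<longleftrightarrow> lam \<notin> ess_spectrum A \<and>
     (\<exists>v\<in>ell2. v \<noteq> (\<lambda>n. 0) \<and> exp_decaying v \<and> A v = (\<lambda>n. lam * v n))"

(* det (Id + K) = sum over n of tr (Lambda^n K) for trace-class K, the trace being computed in the
   basis of the wedge products e_{i_1} /\ ... /\ e_{i_n}, i_1 < ... < i_n: the diagonal
   entry of Lambda^n K at S = {i_1, ..., i_n} is the principal minor of K with index set S.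
   The argument A below is the whole operator Id + K. *)
definition fredholm_det :: "((nat \<Rightarrow> complex) \<Rightarrow> (nat \<Rightarrow> complex)) \<Rightarrow> complex" where
  "fredholm_det A =
     (let K = (\<lambda>i j. entry A i j - (if i = j then 1 else 0)) in
      \<Sum>n. \<Sum>\<^sub>\<infinity>S\<in>{S. finite S \<and> card S = n}.
        Determinant.det (mat n n (\<lambda>(p, q).
          K (sorted_list_of_set S ! p) (sorted_list_of_set S ! q))))"

definition fourier_coeff :: "(complex \<Rightarrow> complex) \<Rightarrow> int \<Rightarrow> complex" where
  "fourier_coeff h n =
     integral {0..2 * pi} (\<lambda>t. h (cis t) * cis (- (of_int n * t))) / of_real (2 * pi)"

definition block_toeplitz :: "nat \<Rightarrow> (complex \<Rightarrow> complex mat) \<Rightarrow> nat \<Rightarrow> nat \<Rightarrow> complex" where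
  "block_toeplitz k g p q =
     fourier_coeff (\<lambda>z. g z $$ (p mod k, q mod k)) (int (p div k) - int (q div k))"

definition tridiag :: "nat \<Rightarrow> (nat \<Rightarrow> complex) \<Rightarrow> (nat \<Rightarrow> complex) \<Rightarrow> nat \<Rightarrow> nat \<Rightarrow> complex" where
  "tridiag k a b i j =
     (if i = j then a (i mod k)
      else if j = i + 1 then b (i mod k)
      else if i = j + 1 then b (j mod k)
      else 0)"

definition tridiag_op ::
    "nat \<Rightarrow> (nat \<Rightarrow> complex) \<Rightarrow> (nat \<Rightarrow> complex) \<Rightarrow> (nat \<Rightarrow> complex) \<Rightarrow> (nat \<Rightarrow> complex)" where
  "tridiag_op k a b = op_of (tridiag k a b)"

definition A_zero :: "nat \<Rightarrow> (nat \<Rightarrow> complex) \<Rightarrow> (nat \<Rightarrow> complex) \<Rightarrow> complex mat" where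
  "A_zero k a b = mat k k (\<lambda>(i, j). tridiag k a b i j)"

definition A_minus :: "nat \<Rightarrow> (nat \<Rightarrow> complex) \<Rightarrow> complex mat" where
  "A_minus k b = mat k k (\<lambda>(i, j). if i = k - 1 \<and> j = 0 then b (k - 1) else 0)"

definition A_plus :: "nat \<Rightarrow> (nat \<Rightarrow> complex) \<Rightarrow> complex mat" where
  "A_plus k b = mat k k (\<lambda>(i, j). if i = 0 \<and> j = k - 1 then b (k - 1) else 0)"

definition symbol ::
    "nat \<Rightarrow> (nat \<Rightarrow> complex) \<Rightarrow> (nat \<Rightarrow> complex) \<Rightarrow> complex \<Rightarrow> complex mat" where
  "symbol k a b z = inverse z \<cdot>\<^sub>m A_minus k b + A_zero k a b + z \<cdot>\<^sub>m A_plus k b"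

definition shifted_symbol ::
    "nat \<Rightarrow> (nat \<Rightarrow> complex) \<Rightarrow> (nat \<Rightarrow> complex) \<Rightarrow> complex \<Rightarrow> complex \<Rightarrow> complex mat" where
  "shifted_symbol k a b lam z = symbol k a b z - lam \<cdot>\<^sub>m 1\<^sub>m k"

(* For k = 1 this is the 0 x 0 matrix, whose spectrum is empty. *)
definition B_zero :: "nat \<Rightarrow> (nat \<Rightarrow> complex) \<Rightarrow> (nat \<Rightarrow> complex) \<Rightarrow> complex mat" where
  "B_zero k a b = mat (k - 1) (k - 1) (\<lambda>(i, j). A_zero k a b $$ (i, j))"

(* z1, z2 are the roots, with multiplicity, of the quadratic polynomial z det (f z - lambda Id). *)
definition Gamma_set :: "nat \<Rightarrow> (nat \<Rightarrow> complex) \<Rightarrow> (nat \<Rightarrow> complex) \<Rightarrow> complex set" where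
  "Gamma_set k a b = {lam. \<exists>c z1 z2. c \<noteq> 0 \<and>
     (\<forall>z. z \<noteq> 0 \<longrightarrow>
        z * Determinant.det (shifted_symbol k a b lam z) = c * (z - z1) * (z - z2)) \<and>
     norm z1 = norm z2}"

(* Off Gamma_set the shifted symbol is invertible at every z with |z| = 1, so mat_inverse
   is Some there; the values at other z do not enter the Fourier coefficients. *)
definition inverse_symbol ::
    "nat \<Rightarrow> (nat \<Rightarrow> complex) \<Rightarrow> (nat \<Rightarrow> complex) \<Rightarrow> complex \<Rightarrow> complex \<Rightarrow> complex mat" where
  "inverse_symbol k a b lam z = the (mat_inverse (shifted_symbol k a b lam z))"

definition C_zero :: "nat \<Rightarrow> (nat \<Rightarrow> complex) \<Rightarrow> (nat \<Rightarrow> complex) \<Rightarrow> complex \<Rightarrow> complex" where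
  "C_zero k a b lam =
     fredholm_det (op_of (block_toeplitz k (inverse_symbol k a b lam)) \<circ>
                   op_of (block_toeplitz k (shifted_symbol k a b lam)))"

definition G_zero :: "nat \<Rightarrow> (nat \<Rightarrow> complex) \<Rightarrow> (nat \<Rightarrow> complex) \<Rightarrow> complex set" where
  "G_zero k a b = {lam. lam \<notin> Gamma_set k a b \<and> C_zero k a b lam = 0}"

lemma has_integral_cis_period:
  "((\<lambda>t. cis (of_int m * t)) has_integral (if m = 0 then of_real (2 * pi) else 0)) {0..2 * pi}"
proof (cases "m = 0")
  case True
  have "((\<lambda>t. 1 :: complex) has_integral (measure lborel {0..2 * pi} *\<^sub>R 1)) {0..2 * pi}"
    by (rule has_integral_const_real)
  with True show ?thesis by (simp add: scaleR_conv_of_real)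
next
  case False
  define F where "F = (\<lambda>z :: complex. exp (\<i> * of_int m * z) / (\<i> * of_int m))"
  have "((\<lambda>t. cis (of_int m * t)) has_integral
        (F (of_real (2 * pi)) - F (of_real 0))) {0..2 * pi}"
  proof (rule fundamental_theorem_of_calculus)
    fix t :: real
    have "(F has_field_derivative exp (\<i> * of_int m * of_real t)) (at (of_real t))"
      unfolding F_def using False by (auto intro!: derivative_eq_intros)
    hence "((\<lambda>t. F (of_real t)) has_vector_derivative exp (\<i> * of_int m * of_real t))
            (at t within {0..2 * pi})"
      by (rule has_vector_derivative_real_field)
    thus "((\<lambda>t. F (of_real t)) has_vector_derivative cis (of_int m * t))
            (at t within {0..2 * pi})"
      by (simp add: cis_conv_exp mult_ac)
  qed auto
  moreover have "F (of_real (2 * pi)) = F (of_real 0)"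
  proof -
    have "exp (\<i> * of_int m * of_real (2 * pi)) = 1"
      using exp_integer_2pi[of "of_int m"] by (simp add: mult_ac)
    thus ?thesis by (simp add: F_def)
  qed
  ultimately show ?thesis using False by simp
qed

lemma fourier_coeff_laurent:
  assumes "\<And>t. h (cis t) = u * inverse (cis t) + v + cis t * w"
  shows "fourier_coeff h n = (if n = -1 then u else if n = 0 then v else if n = 1 then w else 0)"
proof -
  have eq: "h (cis t) * cis (- (of_int n * t)) =
      u * cis (of_int (-1 - n) * t) + v * cis (of_int (- n) * t) + w * cis (of_int (1 - n) * t)"
    for t
    unfolding assms by (simp add: algebra_simps cis_mult)
  have "((\<lambda>t. h (cis t) * cis (- (of_int n * t))) has_integral
      (u * (if -1 - n = 0 then of_real (2 * pi) else 0) + v * (if - n = 0 then of_real (2 * pi) else 0)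
        + w * (if 1 - n = 0 then of_real (2 * pi) else 0))) {0..2 * pi}"
    unfolding eq by (intro has_integral_add has_integral_mult_right has_integral_cis_period)
  from integral_unique[OF this] show ?thesis
    by (auto simp: fourier_coeff_def)
qed

lemma block_toeplitz_symbol:
  assumes "k \<ge> 1"
  shows "block_toeplitz k (symbol k a b) p q = tridiag k a b p q"
proof -
  define P i Q j where defs: "P = p div k" "i = p mod k" "Q = q div k" "j = q mod k"
  have p: "p = k * P + i" and q: "q = k * Q + j" and ij: "i < k" "j < k"
    using assms by (auto simp: defs)
  have "block_toeplitz k (symbol k a b) p q =
    (if int P - int Q = -1 then A_minus k b $$ (i, j) else if int P - int Q = 0 then A_zero k a b $$ (i, j)
     else if int P - int Q = 1 then A_plus k b $$ (i, j) else 0)"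
    unfolding block_toeplitz_def defs(1-4)[symmetric]
    by (rule fourier_coeff_laurent)
       (use ij in \<open>simp add: symbol_def A_minus_def A_zero_def A_plus_def\<close>)
  also have "\<dots> = tridiag k a b p q"
  proof -
    consider "Q = P" | "Q = Suc P" | "P = Suc Q" | "Q \<ge> P + 2" | "P \<ge> Q + 2" by linarith
    thus ?thesis
    proof cases
      case 1
      thus ?thesis using ij by (auto simp: A_zero_def tridiag_def p q)
    next
      case 2
      thus ?thesis using ij by (auto simp: A_minus_def tridiag_def p q)
    next
      case 3
      thus ?thesis using ij by (auto simp: A_plus_def tridiag_def p q)
    next
      case 4
      then obtain d where "Q = P + 2 + d" using le_Suc_ex by blast
      thus ?thesis using ij by (auto simp: tridiag_def p q algebra_simps)
    next
      case 5
      then obtain d where "P = Q + 2 + d" using le_Suc_ex by blast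
      thus ?thesis using ij by (auto simp: tridiag_def p q algebra_simps)
    qed
  qed
  finally show ?thesis .
qed

end

theory Submission
  imports Defs
begin

text \<open>An eigenvector \<open>v\<close> of \<open>T\<close> tending to zero and its translate by one period solve the same
  three-term recurrence, and their constant Wronskian tends to zero. Hence \<open>v\<close> is a Bloch solution:
  it is multiplied by some \<open>\<mu>\<close> with \<open>|\<mu>| < 1\<close> over each period, and comparing the rows \<open>0\<close>
  and \<open>k\<close> gives \<open>v (k - 1) = 0\<close>, so that its first \<open>k - 1\<close> entries form an eigenvector of \<open>B_zero\<close>.
  Conversely an eigenvector of \<open>B_zero\<close> extends to a Bloch solution for a unique multiplier \<open>\<mu>\<close>.

  The determinant of the shifted symbol is \<open>q (z + 1/z) + s\<close> with \<open>q \<noteq> 0\<close>, so given a Bloch solution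
  its roots are \<open>\<mu>\<close> and \<open>1/\<mu>\<close>, and \<open>\<lambda> \<in> \<Gamma>\<close> iff \<open>|\<mu>| = 1\<close>. The operator in \<open>C_zero\<close> differs from the
  identity in its zeroth column only, so \<open>C_zero\<close> is its corner entry, which comes from one Fourier
  coefficient of one entry of the inverse symbol; by the Bloch solution that entry is
  \<open>z / (b\<^sub>k (1 - \<mu> z))\<close>, and \<open>C_zero\<close> is \<open>0\<close> for \<open>|\<mu>| < 1\<close> and \<open>1\<close> for \<open>|\<mu>| > 1\<close>.

  For \<open>|\<mu>| < 1\<close> the operator \<open>T - \<lambda>\<close> is Fredholm: its kernel is spanned by \<open>v\<close>, and variation of
  constants with the Bloch solution for \<open>1/\<mu>\<close> shows that its range is the closed hyperplane
  \<open>\<Sum>v y = 0\<close>.\<close>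

subsection \<open>The three-term recurrence\<close>

locale tridiagonal_toeplitz =
  fixes k :: nat and a b :: "nat \<Rightarrow> complex" and lam :: complex
  assumes k_pos: "k \<ge> 1" and b_nonzero: "\<And>i. i < k \<Longrightarrow> b i \<noteq> 0"
begin

definition A :: "nat \<Rightarrow> complex" where "A n = a (n mod k) - lam"

definition B :: "nat \<Rightarrow> complex" where "B n = b (n mod k)"

text \<open>Rows \<open>Suc n\<close> vanish on the two-dimensional space of solutions of the
  recurrence, and row \<open>0\<close> adds the boundary condition. Hypotheses on rows
  \<open>Suc n\<close> alone therefore also admit solutions that violate the latter.\<close>

definition row :: "(nat \<Rightarrow> complex) \<Rightarrow> nat \<Rightarrow> complex" where
  "row w n = (if n = 0 then 0 else B (n - 1) * w (n - 1)) + A n * w n + B n * w (Suc n)"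

text \<open>The weight \<open>B n\<close> makes this discrete Wronskian constant along two solutions
  of the recurrence.\<close>

definition wronskian :: "(nat \<Rightarrow> complex) \<Rightarrow> (nat \<Rightarrow> complex) \<Rightarrow> nat \<Rightarrow> complex" where
  "wronskian v w n = B n * (v n * w (Suc n) - v (Suc n) * w n)"

lemma B_nonzero [simp]: "B n \<noteq> 0"
  using k_pos b_nonzero by (simp add: B_def)

lemma B_add_period [simp]: "B (n + k) = B n" and A_add_period [simp]: "A (n + k) = A n"
  by (simp_all add: A_def B_def)

lemma row_0: "row w 0 = A 0 * w 0 + B 0 * w (Suc 0)"
  and row_Suc: "row w (Suc n) = B n * w n + A (Suc n) * w (Suc n) + B (Suc n) * w (Suc (Suc n))"
  by (simp_all add: row_def)

text \<open>Stated from row \<open>1\<close> on: row \<open>k\<close> contains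
  \<open>B (k - 1) * w (k - 1)\<close>, which row \<open>0\<close> of the translate lacks.\<close>

lemma row_shift: "row (\<lambda>n. w (n + k)) (Suc n) = row w (Suc n + k)"
  using B_add_period[of n] B_add_period[of "Suc n"] A_add_period[of "Suc n"] by (simp add: row_Suc)

lemma row_scale: "row (\<lambda>n. c * w n) n = c * row w n"
  by (simp add: row_def algebra_simps)

lemma tridiag_op_row: "op_minus_scalar (tridiag_op k a b) lam w n = row w n"
proof -
  have "tridiag_op k a b w n = (\<Sum>m\<in>{n - 1..Suc n}. tridiag k a b n m * w m)"
    unfolding tridiag_op_def op_of_def
    by (rule suminf_finite) (auto simp: tridiag_def)
  also have "\<dots> = row w n + lam * w n"
  proof (cases n)
    case 0
    then show ?thesis
      by (simp add: tridiag_def row_def A_def B_def algebra_simps)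
  next
    case (Suc m)
    have "{n - 1..Suc n} = {m, Suc m, Suc (Suc m)}" using Suc by auto
    then show ?thesis
      using Suc by (simp add: tridiag_def row_def A_def B_def algebra_simps)
  qed
  finally show ?thesis by (simp add: op_minus_scalar_def)
qed

lemma tridiag_op_eigen_iff:
  "tridiag_op k a b v = (\<lambda>n. lam * v n) \<longleftrightarrow> (\<forall>n. row v n = 0)"
  by (simp add: tridiag_op_row[symmetric] op_minus_scalar_def fun_eq_iff)

lemma coefficients_bounded: "\<exists>M > 0. \<forall>n. norm (B n) \<le> M \<and> norm (A n) \<le> M"
proof -
  define M where "M = 1 + (\<Sum>i<k. norm (b i)) + (\<Sum>i<k. norm (a i - lam))"
  have nn: "(\<Sum>i<k. norm (b i)) \<ge> 0" "(\<Sum>i<k. norm (a i - lam)) \<ge> 0"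
    by (auto intro: sum_nonneg)
  have "norm (B n) \<le> (\<Sum>i<k. norm (b i))" "norm (A n) \<le> (\<Sum>i<k. norm (a i - lam))" for n
    unfolding A_def B_def using k_pos
    by (auto intro!: member_le_sum[where i = "n mod k" and f = "\<lambda>i. norm (b i)"]
          member_le_sum[where i = "n mod k" and f = "\<lambda>i. norm (a i - lam)"])
  with nn have "M > 0" "norm (B n) \<le> M" "norm (A n) \<le> M" for n
    by (auto simp: M_def add_increasing add_increasing2 intro: add_nonneg_pos order_trans)
  then show ?thesis by blast
qed

lemma wronskian_0: "wronskian v w 0 = v 0 * row w 0 - w 0 * row v 0"
  by (simp add: wronskian_def row_0 algebra_simps)

lemma wronskian_Suc:
  "wronskian v w (Suc n) = wronskian v w n + (v (Suc n) * row w (Suc n) - w (Suc n) * row v (Suc n))"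
  by (simp add: wronskian_def row_Suc algebra_simps)

text \<open>The diagonal terms cancel and the rest telescopes. Row \<open>0\<close> has no left
  neighbour, hence no boundary term arises at the left end.\<close>

lemma green_identity: "(\<Sum>i\<le>n. v i * row w i - w i * row v i) = wronskian v w n"
  by (induction n) (simp_all add: wronskian_0 wronskian_Suc)

lemma wronskian_const:
  assumes "\<And>n. row v (Suc n) = 0" "\<And>n. row w (Suc n) = 0"
  shows "wronskian v w n = wronskian v w 0"
  by (induction n) (simp_all add: wronskian_Suc assms)

lemma recurrence_unique:
  assumes v: "\<And>n. row v (Suc n) = 0" and w: "\<And>n. row w (Suc n) = 0"
    and 0: "w 0 = s * v 0" "w 1 = s * v 1"
  shows "w n = s * v n"
proof -
  have "w n = s * v n \<and> w (Suc n) = s * v (Suc n)"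
  proof (induction n)
    case 0
    then show ?case using assms by simp
  next
    case (Suc n)
    have "B (Suc n) * w (Suc (Suc n)) = - (B n * w n + A (Suc n) * w (Suc n))"
      using w[of n] unfolding row_Suc by (simp add: add_eq_0_iff2 add_eq_0_iff)
    also have "\<dots> = s * (- (B n * v n + A (Suc n) * v (Suc n)))"
      using Suc by (simp add: algebra_simps)
    also have "- (B n * v n + A (Suc n) * v (Suc n)) = B (Suc n) * v (Suc (Suc n))"
      using v[of n] unfolding row_Suc by (simp add: add_eq_0_iff2 add_eq_0_iff)
    finally show ?case using Suc by simp
  qed
  then show ?thesis by simp
qed

text \<open>A zero Wronskian makes the initial data proportional, and these determine the
  solution.\<close>

lemma wronskian_zero_proportional:
  assumes v: "\<And>n. row v (Suc n) = 0" and w: "\<And>n. row w (Suc n) = 0"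
    and W: "wronskian v w 0 = 0" and v0: "v 0 \<noteq> 0"
  shows "w n = w 0 / v 0 * v n"
proof (rule recurrence_unique[OF v w])
  show "w 0 = w 0 / v 0 * v 0" using v0 by simp
  have "v 0 * w 1 - v 1 * w 0 = 0" using W by (simp add: wronskian_def del: right_minus_eq)
  then have "v 0 * w 1 = w 0 * v 1" by (simp only: right_minus_eq mult.commute)
  then have "w 1 = w 0 * v 1 / v 0" using v0 by (metis nonzero_mult_div_cancel_left)
  then show "w 1 = w 0 / v 0 * v 1" by simp
qed

text \<open>All \<open>B n\<close> are nonzero, so the recurrence can be solved for the earlier
  term. Only rows \<open>1\<close> to \<open>N\<close> enter, so a finite vector padded by zeros
  qualifies as well.\<close>

lemma backward_zero:
  assumes "\<And>n. n < N \<Longrightarrow> row w (Suc n) = 0" "w N = 0" "w (Suc N) = 0"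
  shows "w 0 = 0"
  using assms
proof (induction N)
  case (Suc N)
  from Suc.prems(1)[of N] Suc.prems(2,3) have "w N = 0" by (simp add: row_Suc)
  with Suc show ?case by simp
qed

lemma wronskian_tendsto_0:
  assumes v: "v \<longlonglongrightarrow> 0" and w: "w \<longlonglongrightarrow> 0"
  shows "wronskian v w \<longlonglongrightarrow> 0"
proof -
  obtain M where M: "\<forall>n. norm (B n) \<le> M" using coefficients_bounded by blast
  have 0: "(\<lambda>n. v n * w (Suc n) - v (Suc n) * w n) \<longlonglongrightarrow> 0"
    using tendsto_diff[OF tendsto_mult[OF v LIMSEQ_Suc[OF w]] tendsto_mult[OF LIMSEQ_Suc[OF v] w]]
    by simp
  have "(\<lambda>n. (v n * w (Suc n) - v (Suc n) * w n) * B n) \<longlonglongrightarrow> 0"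
    by (rule lim_null_mult_right_bounded[OF 0, where B = M]) (simp add: M)
  then show ?thesis unfolding wronskian_def[abs_def] by (simp add: mult.commute)
qed

text \<open>A Floquet solution that meets the boundary condition at \<open>0\<close>. The modulus of
  \<mu> is left free, because an eigenvector of \<open>B_zero\<close> may also extend to a growing
  solution.\<close>

definition bloch :: "complex \<Rightarrow> (nat \<Rightarrow> complex) \<Rightarrow> bool" where
  "bloch \<mu> v \<longleftrightarrow> \<mu> \<noteq> 0 \<and> v 0 \<noteq> 0 \<and> v (k - 1) = 0 \<and> (\<forall>n. v (n + k) = \<mu> * v n) \<and> (\<forall>n. row v n = 0)"

lemma period_power:
  assumes "\<And>n. w (n + k) = \<rho> * w n"
  shows "w (n + m * k) = \<rho> ^ m * (w n :: complex)"
  by (induction m) (use assms[of "n + _ * k"] in \<open>simp_all add: algebra_simps\<close>)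

lemma bloch_if_null_sequence:
  assumes row: "\<And>n. row v n = 0" and nz: "v \<noteq> (\<lambda>n. 0)" and lim: "v \<longlonglongrightarrow> 0"
  obtains \<mu> where "bloch \<mu> v" "norm \<mu> < 1"
proof -
  have v0: "v 0 \<noteq> 0"
  proof
    assume "v 0 = 0"
    moreover from this row[of 0] have "v 1 = 0" by (simp add: row_0)
    ultimately have "v n = 0 * v n" for n
      using recurrence_unique[OF row row, of 0 n] by simp
    then show False using nz by auto
  qed
  define \<mu> where "\<mu> = v k / v 0"
  have row_w: "row (\<lambda>n. v (n + k)) (Suc n) = 0" for n
    unfolding row_shift by (rule row)
  have "wronskian v (\<lambda>n. v (n + k)) = (\<lambda>_. wronskian v (\<lambda>n. v (n + k)) 0)"
    using wronskian_const[OF row row_w] by blast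
  moreover have "wronskian v (\<lambda>n. v (n + k)) \<longlonglongrightarrow> 0"
    by (intro wronskian_tendsto_0 lim LIMSEQ_ignore_initial_segment)
  ultimately have "wronskian v (\<lambda>n. v (n + k)) 0 = 0"
    by (metis LIMSEQ_const_iff)
  from wronskian_zero_proportional[OF row row_w this v0]
  have per: "v (n + k) = \<mu> * v n" for n by (simp add: \<mu>_def)
  have "row v k = 0" "row v 0 = 0" by (rule row)+
  \<comment> \<open>Row \<open>k\<close> is \<mu> times row \<open>0\<close> plus the coupling to
    the preceding period, which must therefore vanish.\<close>
  moreover have "row v k = B (k - 1) * v (k - 1) + \<mu> * row v 0"
    using k_pos per[of 0] per[of 1] A_add_period[of 0] B_add_period[of 0]
    by (simp add: row_def algebra_simps)
  ultimately have vk: "v (k - 1) = 0" by simp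
  have "\<mu> \<noteq> 0"
  proof
    assume "\<mu> = 0"
    then have zero: "v (n + k) = 0" for n using per by simp
    \<comment> \<open>All entries from \<open>k\<close> on vanish, and the backward recurrence
      carries this down to index \<open>0\<close>.\<close>
    have "v 0 = 0"
      using zero[of 0] zero[of 1] by (intro backward_zero[of k v, OF row]) auto
    with v0 show False by simp
  qed
  moreover have "norm \<mu> < 1"
  proof (rule ccontr)
    assume *: "\<not> norm \<mu> < 1"
    have "(\<lambda>m. v (m * k)) \<longlonglongrightarrow> 0"
      using LIMSEQ_subseq_LIMSEQ[OF lim, of "\<lambda>m. m * k"] k_pos
      by (simp add: strict_mono_def comp_def)
    then have "(\<lambda>m. norm (v (m * k))) \<longlonglongrightarrow> 0" by (rule tendsto_norm_zero)
    moreover have "norm (v (m * k)) \<ge> norm (v 0)" for m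
      using * period_power[of v \<mu> 0 m, OF per] by (simp add: norm_mult norm_power mult_le_cancel_right1)
    ultimately have "norm (v 0) \<le> 0" by (intro LIMSEQ_le_const) auto
    with v0 show False by simp
  qed
  ultimately show ?thesis using that v0 vk per row by (auto simp: bloch_def)
qed

end

subsection \<open>Determinant and spectrum\<close>

text \<open>The cofactors along row \<open>i\<close> do not involve row \<open>i\<close>, so the
  Laplace expansions of both matrices along it share them.\<close>

lemma det_change_entry:
  fixes M N :: "'a :: comm_ring_1 mat"
  assumes M: "M \<in> carrier_mat n n" and N: "N \<in> carrier_mat n n" and ij: "i < n" "j < n"
    and eq: "\<And>r c. r < n \<Longrightarrow> c < n \<Longrightarrow> (r, c) \<noteq> (i, j) \<Longrightarrow> N $$ (r, c) = M $$ (r, c)"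
  shows "Determinant.det N = Determinant.det M + (N $$ (i, j) - M $$ (i, j)) * cofactor M i j"
proof -
  have "mat_delete N i c = mat_delete M i c" for c
    unfolding mat_delete_def using M N eq by (intro eq_matI) auto
  then have cof: "cofactor N i c = cofactor M i c" for c by (simp add: cofactor_def)
  have "Determinant.det N = (\<Sum>c<n. M $$ (i, c) * cofactor M i c
      + (if c = j then (N $$ (i, j) - M $$ (i, j)) * cofactor M i j else 0))"
    unfolding laplace_expansion_row[OF N ij(1)] cof
    by (intro sum.cong) (use eq ij in \<open>auto simp: algebra_simps\<close>)
  also have "\<dots> = Determinant.det M + (N $$ (i, j) - M $$ (i, j)) * cofactor M i j"
    unfolding laplace_expansion_row[OF M ij(1)] using ij by (simp add: sum.distrib)
  finally show ?thesis .
qed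

context tridiagonal_toeplitz
begin

text \<open>The matrix of the operator minus \<open>lam\<close>; the shift sits in
  \<open>A\<close>.\<close>

definition band :: "nat \<Rightarrow> nat \<Rightarrow> complex" where
  "band i j = (if i = j then A i else if j = Suc i then B i else if i = Suc j then B j else 0)"

lemma band_symmetric: "band i j = band j i"
  by (simp add: band_def)

lemma tridiag_band: "tridiag k a b i j = band i j + (if i = j then lam else 0)"
  by (simp add: tridiag_def band_def A_def B_def)

text \<open>With \<open>z\<close> and \<open>1/z\<close> separated, the determinant is affine in each variable.\<close>

definition pencil :: "complex \<Rightarrow> complex \<Rightarrow> complex mat" where
  "pencil x y = mat k k (\<lambda>(i, j). band i j
     + (if i = 0 \<and> j = k - 1 then B (k - 1) * x else 0)
     + (if i = k - 1 \<and> j = 0 then B (k - 1) * y else 0))"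

lemma pencil_carrier [simp]: "pencil x y \<in> carrier_mat k k"
  by (simp add: pencil_def)

lemma shifted_symbol_pencil: "shifted_symbol k a b lam z = pencil z (1 / z)"
proof (rule eq_matI)
  fix i j assume "i < dim_row (pencil z (1 / z))" "j < dim_col (pencil z (1 / z))"
  then have ij: "i < k" "j < k" by (simp_all add: pencil_def)
  \<comment> \<open>With abstract conditions the identity also covers \<open>k = 1\<close>, where
    the diagonal and both corners are the same entry.\<close>
  have split: "inverse z * (if R then \<beta> else 0) + (c + (if I then lam else 0)) + z * (if P then \<beta> else 0)
      - lam * (if I then 1 else 0) = c + (if P then \<beta> * z else 0) + (if R then \<beta> * (1 / z) else 0)"
    for R I P and \<beta> c :: complex
    by (simp add: divide_inverse)
  have "shifted_symbol k a b lam z $$ (i, j)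
      = inverse z * (if i = k - 1 \<and> j = 0 then b (k - 1) else 0) + tridiag k a b i j
        + z * (if i = 0 \<and> j = k - 1 then b (k - 1) else 0) - lam * (if i = j then 1 else 0)"
    using ij by (simp add: shifted_symbol_def symbol_def A_minus_def A_plus_def A_zero_def)
  moreover have "pencil z (1 / z) $$ (i, j) = band i j
      + (if i = 0 \<and> j = k - 1 then b (k - 1) * z else 0)
      + (if i = k - 1 \<and> j = 0 then b (k - 1) * (1 / z) else 0)"
    using ij k_pos by (simp add: pencil_def B_def)
  ultimately show "shifted_symbol k a b lam z $$ (i, j) = pencil z (1 / z) $$ (i, j)"
    by (simp only: tridiag_band split)
qed (simp_all add: pencil_def shifted_symbol_def symbol_def A_minus_def A_plus_def A_zero_def)

lemma pencil_det_affine: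
  "Determinant.det (pencil x y) = Determinant.det (pencil 0 y)
     + x * (B (k - 1) * cofactor (pencil 0 y) 0 (k - 1))"
proof -
  have "Determinant.det (pencil x y) = Determinant.det (pencil 0 y) +
      (pencil x y $$ (0, k - 1) - pencil 0 y $$ (0, k - 1)) * cofactor (pencil 0 y) 0 (k - 1)"
    by (rule det_change_entry[of _ k]) (use k_pos in \<open>auto simp: pencil_def\<close>)
  also have "pencil x y $$ (0, k - 1) - pencil 0 y $$ (0, k - 1) = B (k - 1) * x"
    using k_pos by (auto simp: pencil_def)
  finally show ?thesis by (simp add: mult_ac)
qed

text \<open>Exchanging the two corners transposes the matrix. Here the symmetry of the operator
  enters: it makes the determinant of the symbol invariant under inversion of z.\<close>

lemma pencil_det_symmetric: "Determinant.det (pencil x y) = Determinant.det (pencil y x)"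
proof -
  have "pencil y x = transpose_mat (pencil x y)"
    by (intro eq_matI) (simp_all add: pencil_def band_symmetric conj_commute)
  then show ?thesis using det_transpose[OF pencil_carrier] by simp
qed

text \<open>Removing row \<open>0\<close> and the last column moves the subdiagonal onto the
  diagonal: the minor is upper triangular with diagonal entries \<open>B 0\<close>, ...,
  \<open>B (k - 2)\<close>.\<close>

lemma pencil_cofactor_nonzero: "cofactor (pencil 0 0) 0 (k - 1) \<noteq> 0"
proof -
  let ?D = "mat_delete (pencil 0 0) 0 (k - 1)"
  have D: "?D \<in> carrier_mat (k - 1) (k - 1)"
    by (rule mat_delete_carrier) simp
  have entry: "?D $$ (i, j) = pencil 0 0 $$ (Suc i, j)" if "i < k - 1" "j < k - 1" for i j
    using that by (simp add: mat_delete_def pencil_def)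
  have "upper_triangular ?D"
  proof (rule upper_triangularI)
    fix i j assume ij: "j < i" "i < dim_row ?D"
    then have "i < k - 1" by (simp add: pencil_def)
    with ij show "?D $$ (i, j) = 0"
      by (subst entry) (auto simp: pencil_def band_def)
  qed
  moreover have "0 \<notin> set (diag_mat ?D)"
  proof
    assume "0 \<in> set (diag_mat ?D)"
    then obtain i where i: "i < k - 1" "?D $$ (i, i) = 0"
      using D by (auto simp: diag_mat_def)
    then show False by (subst (asm) entry) (auto simp: pencil_def band_def split: if_splits)
  qed
  ultimately show ?thesis
    using upper_triangular_imp_det_eq_0_iff[OF D] by (simp add: cofactor_def)
qed

lemma symbol_det:
  obtains q s where "q \<noteq> 0"
    "\<And>z. z \<noteq> 0 \<Longrightarrow> Determinant.det (shifted_symbol k a b lam z) = q * (z + 1 / z) + s"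
proof -
  define D where "D = (\<lambda>x y. Determinant.det (pencil x y))"
  define q where "q = B (k - 1) * cofactor (pencil 0 0) 0 (k - 1)"
  define r where "r = (\<lambda>y. B (k - 1) * cofactor (pencil 0 y) 0 (k - 1))"
  have sym: "D x y = D y x" for x y
    unfolding D_def by (rule pencil_det_symmetric)
  have aff: "D x y = D 0 y + x * r y" for x y
    unfolding D_def r_def by (rule pencil_det_affine)
  have r0: "r 0 = q" by (simp add: r_def q_def)
  \<comment> \<open>Being affine in one variable and symmetric, \<open>D\<close> is affine in each.
    The slope \<open>r y\<close> is found by exchanging the arguments \<open>1\<close> and
    \<open>y\<close>.\<close>
  have biaffine: "D x y = D 0 0 + q * (x + y) + x * y * (r 1 - q)" for x y
  proof -
    have 0: "D 0 y = D 0 0 + y * q" for y using sym[of 0 y] aff[of y 0] by (simp only: r0)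
    have 1: "D x y = D 0 0 + y * q + x * r y" for x y using aff[of x y] 0[of y] by (simp only:)
    have "D 0 0 + y * q + 1 * r y = D 0 0 + 1 * q + y * r 1"
      using sym[of 1 y] unfolding 1[of 1 y] 1[of y 1] .
    then have r: "r y = q + y * (r 1 - q)" by (simp add: algebra_simps)
    show ?thesis unfolding 1[of x y] r by (simp add: algebra_simps)
  qed
  \<comment> \<open>For y = 1/z the mixed term is constant and is absorbed into
    \<open>s\<close>.\<close>
  have "D z (1 / z) = q * (z + 1 / z) + (D 0 0 + (r 1 - q))" if "z \<noteq> 0" for z
    unfolding biaffine[of z "1 / z"] using that by simp
  then have "Determinant.det (shifted_symbol k a b lam z) = q * (z + 1 / z) + (D 0 0 + (r 1 - q))"
    if "z \<noteq> 0" for z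
    using that by (simp only: shifted_symbol_pencil D_def)
  moreover have "q \<noteq> 0" using pencil_cofactor_nonzero by (simp add: q_def)
  ultimately show ?thesis using that by blast
qed

section \<open>Quasi-periodic sequences and the kernel of the symbol\<close>

lemma sum_tridiag:
  assumes "i < m"
  shows "(\<Sum>j<m. tridiag k a b i j * w j) = (if i = 0 then 0 else B (i - 1) * w (i - 1))
    + (A i + lam) * w i + (if Suc i < m then B i * w (Suc i) else 0)"
proof -
  have "(\<Sum>j<m. tridiag k a b i j * w j) = (\<Sum>j<m. (if j = i then (A i + lam) * w i else 0)
     + (if j = Suc i then B i * w (Suc i) else 0)
     + (if j = i - 1 then (if i = 0 then 0 else B (i - 1) * w (i - 1)) else 0))"
    by (rule sum.cong) (auto simp: tridiag_def A_def B_def)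
  then show ?thesis using assms by (simp add: sum.distrib less_imp_diff_less)
qed

lemma shifted_symbol_carrier [simp]: "shifted_symbol k a b lam z \<in> carrier_mat k k"
  by (simp add: shifted_symbol_pencil)

lemma shifted_symbol_entry:
  "i < k \<Longrightarrow> j < k \<Longrightarrow> shifted_symbol k a b lam z $$ (i, j) =
     (tridiag k a b i j - (if i = j then lam else 0))
     + (if i = 0 \<and> j = k - 1 then B (k - 1) * z else 0)
     + (if i = k - 1 \<and> j = 0 then B (k - 1) / z else 0)"
  by (simp add: shifted_symbol_pencil pencil_def tridiag_band)

lemma symbol_mult_vec:
  assumes i: "i < k"
  shows "(shifted_symbol k a b lam z *\<^sub>v Matrix.vec k w) $ i =
     (if i = 0 then z * B (k - 1) * w (k - 1) else B (i - 1) * w (i - 1)) + A i * w i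
     + (if i = k - 1 then B (k - 1) * w 0 / z else B i * w (Suc i))"
proof -
  have "(shifted_symbol k a b lam z *\<^sub>v Matrix.vec k w) $ i
      = (\<Sum>j<k. shifted_symbol k a b lam z $$ (i, j) * w j)"
    using i carrier_matD[OF shifted_symbol_carrier[of z]]
    by (simp add: scalar_prod_def lessThan_atLeast0 row_def)
  also have "\<dots> = (\<Sum>j<k. tridiag k a b i j * w j - (if j = i then lam * w i else 0)
     + (if j = k - 1 then (if i = 0 then z * B (k - 1) * w (k - 1) else 0) else 0)
     + (if j = 0 then (if i = k - 1 then B (k - 1) * w 0 / z else 0) else 0))"
    by (rule sum.cong) (use i in \<open>auto simp: shifted_symbol_entry algebra_simps\<close>)
  also have "\<dots> = (\<Sum>j<k. tridiag k a b i j * w j) - lam * w i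
     + (if i = 0 then z * B (k - 1) * w (k - 1) else 0)
     + (if i = k - 1 then B (k - 1) * w 0 / z else 0)"
    using i by (simp add: sum.distrib sum_subtractf)
  also have "\<dots> = (if i = 0 then z * B (k - 1) * w (k - 1) else B (i - 1) * w (i - 1)) + A i * w i
     + (if i = k - 1 then B (k - 1) * w 0 / z else B i * w (Suc i))"
    unfolding sum_tridiag[OF i] using i by (auto simp: algebra_simps)
  finally show ?thesis .
qed

text \<open>The neighbours of a period are its last entry divided by \<rho> and its first entry
  times \<rho>; at z = 1/\<rho> the corners of the symbol supply exactly these. The row is taken at
  \<open>i + k\<close>, since row \<open>0\<close> has no left neighbour.\<close>

lemma symbol_mult_quasi_periodic:
  assumes per: "\<And>n. w (n + k) = \<rho> * w n" and "\<rho> \<noteq> 0" and i: "i < k"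
  shows "(shifted_symbol k a b lam (1 / \<rho>) *\<^sub>v Matrix.vec k w) $ i = local.row w (i + k) / \<rho>"
proof -
  have 1: "w (Suc (i + k)) = \<rho> * w (Suc i)" "w (i + k) = \<rho> * w i" "w k = \<rho> * w 0"
    using per[of "Suc i"] per[of i] per[of 0] by auto
  have 2: "w (i + k - 1) = \<rho> * w (i - 1)" "B (i + k - 1) = B (i - 1)" if "i > 0"
    using per[of "i - 1"] B_add_period[of "i - 1"] that by auto
  show ?thesis
  \<comment> \<open>For \<open>k = 1\<close> the period is a single entry and both corner terms fall
    on the same position.\<close>
  proof (cases "k = 1")
    case True
    have i0: "i = 0" and k0: "k - 1 = 0" using True i by auto
    have "w (Suc k) = \<rho> * (\<rho> * w 0)" using per[of 0] per[of k] True by simp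
    then have "local.row w (i + k) = B 0 * w 0 + A 0 * (\<rho> * w 0) + B 0 * (\<rho> * (\<rho> * w 0))"
      using i0 k0 k_pos per[of 0] B_add_period[of 0] A_add_period[of 0] by (simp add: local.row_def)
    then show ?thesis
      unfolding symbol_mult_vec[OF i] using i0 k0 \<open>\<rho> \<noteq> 0\<close> by (simp add: field_simps)
  next
    case False
    have 3: "w (Suc i) = \<rho> * w 0" if "i = k - 1"
      using 1(3) that k_pos by simp
    show ?thesis
      unfolding symbol_mult_vec[OF i]
      using \<open>\<rho> \<noteq> 0\<close> False k_pos i 1 2 3 by (auto simp: local.row_def divide_simps algebra_simps)
  qed
qed

lemma row_quasi_periodic:
  assumes per: "\<And>n. w (n + k) = \<rho> * w n"
  shows "local.row w (Suc n + k) = \<rho> * local.row w (Suc n)"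
  using row_shift[of w n] row_scale[of \<rho> w "Suc n"] by (simp add: per)

lemma bloch_det:
  assumes "bloch \<mu> v"
  shows "Determinant.det (shifted_symbol k a b lam (1 / \<mu>)) = 0"
proof -
  have "shifted_symbol k a b lam (1 / \<mu>) *\<^sub>v Matrix.vec k v = 0\<^sub>v k"
    using assms carrier_matD[OF shifted_symbol_carrier]
    by (intro eq_vecI) (auto simp: symbol_mult_quasi_periodic[of v \<mu>] bloch_def simp del: index_mult_mat_vec)
  moreover have "Matrix.vec k v \<noteq> 0\<^sub>v k"
  proof
    assume "Matrix.vec k v = 0\<^sub>v k"
    then have "Matrix.vec k v $ 0 = 0\<^sub>v k $ 0" by (rule arg_cong)
    then show False using assms k_pos by (simp add: bloch_def)
  qed
  ultimately show ?thesis
    using det_0_iff_vec_prod_zero[OF shifted_symbol_carrier] vec_carrier by blast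
qed

lemma bloch_symbol_det:
  assumes "bloch \<mu> v"
  obtains q where "q \<noteq> 0"
    "\<And>z. z \<noteq> 0 \<Longrightarrow> z * Determinant.det (shifted_symbol k a b lam z) = q * (z - \<mu>) * (z - 1 / \<mu>)"
proof -
  obtain q s where q: "q \<noteq> 0" and det:
    "\<And>z. z \<noteq> 0 \<Longrightarrow> Determinant.det (shifted_symbol k a b lam z) = q * (z + 1 / z) + s"
    using symbol_det by blast
  have \<mu>: "\<mu> \<noteq> 0" using assms by (simp add: bloch_def)
  \<comment> \<open>That 1/\<mu> is a root fixes \<open>s\<close>; by invariance under inversion
    \<mu> is the other root.\<close>
  have s: "s = - q * (\<mu> + 1 / \<mu>)"
    using bloch_det[OF assms] det[of "1 / \<mu>"] \<mu> by (simp add: add_eq_0_iff add_ac)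
  have "z * Determinant.det (shifted_symbol k a b lam z) = q * (z - \<mu>) * (z - 1 / \<mu>)" if "z \<noteq> 0" for z
  proof -
    have "z * (q * (z + 1 / z) + s) = q * (z * z + 1) + z * s"
      using that by (simp add: algebra_simps)
    also have "\<dots> = q * (z - \<mu>) * (z - 1 / \<mu>)"
      using \<mu> by (simp add: s algebra_simps)
    finally show ?thesis using det[OF that] by simp
  qed
  with q that show ?thesis by blast
qed

lemma bloch_Gamma_iff:
  assumes "bloch \<mu> v"
  shows "lam \<in> Gamma_set k a b \<longleftrightarrow> norm \<mu> = 1"
proof -
  obtain q where q: "q \<noteq> 0" and det:
    "\<And>z. z \<noteq> 0 \<Longrightarrow> z * Determinant.det (shifted_symbol k a b lam z) = q * (z - \<mu>) * (z - 1 / \<mu>)"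
    using bloch_symbol_det[OF assms] by blast
  have \<mu>: "\<mu> \<noteq> 0" using assms by (simp add: bloch_def)
  show ?thesis
  proof
    assume "norm \<mu> = 1"
    then have "norm \<mu> = norm (1 / \<mu>)" by (simp add: norm_divide)
    with q det show "lam \<in> Gamma_set k a b" unfolding Gamma_set_def by blast
  next
    assume "lam \<in> Gamma_set k a b"
    then obtain c z1 z2 where c: "c \<noteq> 0" and n: "norm z1 = norm z2" and
      D: "\<And>z. z \<noteq> 0 \<Longrightarrow> z * Determinant.det (shifted_symbol k a b lam z) = c * (z - z1) * (z - z2)"
      unfolding Gamma_set_def by blast
    \<comment> \<open>Each of \<mu> and 1/\<mu> equals \<open>z1\<close> or \<open>z2\<close>. These
      have the same modulus, so it does not matter which is which.\<close>
    have "c * (\<mu> - z1) * (\<mu> - z2) = 0" "c * (1 / \<mu> - z1) * (1 / \<mu> - z2) = 0"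
      using det[of \<mu>] D[of \<mu>] det[of "1 / \<mu>"] D[of "1 / \<mu>"] \<mu> by auto
    then have "norm \<mu> = norm z1" "norm (1 / \<mu>) = norm z1"
      using c n by auto
    then have "norm \<mu> * norm \<mu> = 1" using \<mu> by (simp add: norm_divide divide_simps split: if_splits)
    then show "norm \<mu> = 1" by (simp add: abs_square_eq_1 power2_eq_square[symmetric])
  qed
qed

section \<open>Bloch solutions and eigenvectors of \<open>B_zero\<close>\<close>

lemma bloch_imp_spectrum:
  assumes "bloch \<mu> v"
  shows "lam \<in> spectrum (B_zero k a b)"
proof -
  from assms have v0: "v 0 \<noteq> 0" and vk: "v (k - 1) = 0" and row: "\<And>n. local.row v n = 0"
    by (auto simp: bloch_def)
  have k1: "k - 1 > 0" using v0 vk by (cases "k - 1 = 0") auto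
  have "(B_zero k a b *\<^sub>v Matrix.vec (k - 1) v) $ i = lam * v i" if i: "i < k - 1" for i
  proof -
    have "(B_zero k a b *\<^sub>v Matrix.vec (k - 1) v) $ i = (\<Sum>j<k - 1. tridiag k a b i j * v j)"
      using i by (simp add: B_zero_def A_zero_def scalar_prod_def lessThan_atLeast0)
    \<comment> \<open>The truncation cuts off only the term with \<open>v (k - 1)\<close> in the
      last row, which is zero.\<close>
    also have "\<dots> = lam * v i + local.row v i"
      unfolding sum_tridiag[OF i] local.row_def
      using vk i by (cases "Suc i = k - 1") (auto simp: algebra_simps)
    finally show ?thesis using row by simp
  qed
  then have "B_zero k a b *\<^sub>v Matrix.vec (k - 1) v = lam \<cdot>\<^sub>v Matrix.vec (k - 1) v"
    by (intro eq_vecI) (auto simp: B_zero_def simp del: index_mult_mat_vec)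
  moreover have "Matrix.vec (k - 1) v \<noteq> 0\<^sub>v (k - 1)"
  proof
    assume "Matrix.vec (k - 1) v = 0\<^sub>v (k - 1)"
    then have "Matrix.vec (k - 1) v $ 0 = 0\<^sub>v (k - 1) $ 0" by (rule arg_cong)
    then show False using v0 k1 by simp
  qed
  ultimately show ?thesis
    unfolding spectrum_def eigenvalue_def eigenvector_def
    by (auto simp: B_zero_def intro!: exI[of _ "Matrix.vec (k - 1) v"])
qed

lemma spectrum_imp_bloch:
  assumes "lam \<in> spectrum (B_zero k a b)"
  obtains \<mu> v where "bloch \<mu> v"
proof -
  from assms obtain x where x: "x \<in> carrier_vec (k - 1)" "x \<noteq> 0\<^sub>v (k - 1)"
      "B_zero k a b *\<^sub>v x = lam \<cdot>\<^sub>v x"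
    by (auto simp: spectrum_def eigenvalue_def eigenvector_def B_zero_def)
  \<comment> \<open>Padded by a zero at index \<open>k - 1\<close>, the eigenvector satisfies the
    full rows below \<open>k - 1\<close>.\<close>
  define y where "y = (\<lambda>r. if r < k - 1 then x $ r else 0)"
  have xv: "x = Matrix.vec (k - 1) y" using x(1) by (intro eq_vecI) (auto simp: y_def)
  have k2: "k \<ge> 2"
  proof (rule ccontr)
    assume "\<not> k \<ge> 2"
    then have "k - 1 = 0" by simp
    with x show False by (auto intro!: eq_vecI)
  qed
  have yk: "y (k - 1) = 0" by (simp add: y_def)
  have row_y: "local.row y i = 0" if i: "i < k - 1" for i
  proof -
    have "lam * y i = (B_zero k a b *\<^sub>v x) $ i"
      using i x(1) unfolding x(3) by (simp add: y_def)
    also have "\<dots> = (\<Sum>j<k - 1. tridiag k a b i j * y j)"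
      unfolding xv using i by (simp add: B_zero_def A_zero_def scalar_prod_def lessThan_atLeast0)
    also have "\<dots> = lam * y i + local.row y i"
      unfolding sum_tridiag[OF i] local.row_def
      using yk i by (cases "Suc i = k - 1") (auto simp: algebra_simps)
    finally show ?thesis by simp
  qed
  have y0: "y 0 \<noteq> 0"
  proof
    assume y0: "y 0 = 0"
    have "i < k - 1 \<Longrightarrow> y i = 0 \<and> y (Suc i) = 0" for i
    proof (induction i)
      case 0
      then show ?case using row_y[of 0] y0 by (simp add: row_0)
    next
      case (Suc i)
      then show ?case using row_y[of "Suc i"] by (simp add: row_Suc)
    qed
    then have "x = 0\<^sub>v (k - 1)" unfolding xv by (intro eq_vecI) auto
    with x show False by simp
  qed
  have yk2: "y (k - 2) \<noteq> 0"
  proof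
    assume "y (k - 2) = 0"
    moreover have "y (Suc (k - 2)) = 0" using yk k2 by (simp add: Suc_diff_le[symmetric] numeral_2_eq_2)
    ultimately have "y 0 = 0" by (intro backward_zero[of "k - 2" y, OF row_y]) auto
    with y0 show False by simp
  qed
  \<comment> \<open>Solves row \<open>k - 1\<close> for \<mu>: the diagonal term there is zero, and
    the right neighbour is to be \<open>\<mu> * y 0\<close>.\<close>
  define \<mu> where "\<mu> = - (B (k - 2) * y (k - 2)) / (B (k - 1) * y 0)"
  have \<mu>: "\<mu> \<noteq> 0" using yk2 y0 by (simp add: \<mu>_def)
  define v where "v = (\<lambda>n. \<mu> ^ (n div k) * y (n mod k))"
  have per: "v (n + k) = \<mu> * v n" for n
    using k_pos by (simp add: v_def)
  have v_y: "v n = y n" if "n < k" for n using that by (simp add: v_def)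
  have row_v: "local.row v n = 0" for n
  proof (induction n rule: less_induct)
    case (less n)
    \<comment> \<open>Rows below \<open>k - 1\<close> come from the eigenvector, row
      \<open>k - 1\<close> from the choice of \<mu>, and row \<open>k\<close> from
      \<open>v (k - 1) = 0\<close>. Later rows follow by quasi-periodicity, which relates rows only
      from \<open>1\<close> on.\<close>
    consider "n < k - 1" | "n = k - 1" | "n = k" | "n = Suc (n - k - 1) + k"
      using k2 by linarith
    then show ?case
    proof cases
      case 1
      then have "local.row v n = local.row y n" using v_y by (simp add: local.row_def)
      with 1 show ?thesis by (simp add: row_y)
    next
      case 2
      have [simp]: "Suc (k - Suc 0) = k" "k - Suc (Suc 0) = k - 2" "k - Suc 0 \<noteq> 0" using k2 by auto
      have "v k = \<mu> * y 0" "v (k - 2) = y (k - 2)" "v (k - 1) = 0"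
        using per[of 0] v_y[of 0] v_y[of "k - 2"] v_y[of "k - 1"] k2 yk by auto
      moreover have "B (k - 1) * (\<mu> * y 0) = - (B (k - 2) * y (k - 2))"
        using y0 by (simp add: \<mu>_def)
      ultimately show ?thesis using 2 k2 by (simp add: local.row_def)
    next
      case 3
      have "v (k - 1) = 0" using v_y[of "k - 1"] yk k2 by simp
      moreover have "local.row v 0 = 0" using less[of 0] 3 k2 by simp
      moreover have "local.row v k = B (k - 1) * v (k - 1) + \<mu> * local.row v 0"
        using k_pos per[of 0] per[of 1] A_add_period[of 0] B_add_period[of 0]
        by (simp add: local.row_def algebra_simps)
      ultimately show ?thesis using 3 by simp
    next
      case 4
      have "local.row v (Suc (n - k - 1)) = 0" by (rule less) (use 4 k2 in linarith)
      then show ?thesis using row_quasi_periodic[of v \<mu> "n - k - 1", OF per] 4 by simp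
    qed
  qed
  have "bloch \<mu> v"
    unfolding bloch_def using \<mu> y0 v_y[of 0] v_y[of "k - 1"] yk per row_v k_pos by simp
  with that show ?thesis by blast
qed

text \<open>The determinant vanishes at \<mu> as well as at 1/\<mu>, so a kernel vector of the
  symbol at \<mu> extends to a solution with the reciprocal multiplier. Nothing is claimed about row
  \<open>0\<close>.\<close>

lemma bloch_dual_solution:
  assumes "bloch \<mu> v"
  obtains u where "\<And>n. u (n + k) = 1 / \<mu> * u n" "\<And>n. local.row u (Suc n) = 0" "u \<noteq> (\<lambda>_. 0)"
proof -
  have \<mu>: "\<mu> \<noteq> 0" using assms by (simp add: bloch_def)
  obtain q where "q \<noteq> 0" and det:
    "\<And>z. z \<noteq> 0 \<Longrightarrow> z * Determinant.det (shifted_symbol k a b lam z) = q * (z - \<mu>) * (z - 1 / \<mu>)"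
    using bloch_symbol_det[OF assms] by blast
  from det[of \<mu>] \<mu> have "Determinant.det (shifted_symbol k a b lam \<mu>) = 0" by simp
  then obtain x where x: "x \<in> carrier_vec k" "x \<noteq> 0\<^sub>v k" "shifted_symbol k a b lam \<mu> *\<^sub>v x = 0\<^sub>v k"
    using det_0_iff_vec_prod_zero[OF shifted_symbol_carrier] by blast
  define u where "u = (\<lambda>n. (1 / \<mu>) ^ (n div k) * x $ (n mod k))"
  have per: "u (n + k) = 1 / \<mu> * u n" for n using k_pos by (simp add: u_def)
  have xu: "x = Matrix.vec k u" using x(1) by (intro eq_vecI) (auto simp: u_def)
  have base: "local.row u (i + k) = 0" if "i < k" for i
    using symbol_mult_quasi_periodic[of u "1 / \<mu>", OF per _ that] \<mu> x(3) that
    by (simp add: xu[symmetric] del: index_mult_mat_vec)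
  have "local.row u (i + k) = 0" for i
  proof (induction i rule: less_induct)
    case (less i)
    show ?case
    proof (cases "i < k")
      case False
      then obtain m where m: "i = Suc m" "i = (i - k) + k" using k_pos by (cases i) auto
      have "local.row u i = 0" using less[of "i - k"] m k_pos by simp
      then show ?thesis using row_quasi_periodic[of u "1 / \<mu>" m, OF per] m(1) by simp
    qed (rule base)
  qed
  \<comment> \<open>Rows from \<open>k\<close> on are known to vanish; the nonzero multiplier
    carries this back to rows \<open>1\<close> to \<open>k - 1\<close>.\<close>
  then have "local.row u (Suc n) = 0" for n
    using row_quasi_periodic[of u "1 / \<mu>" n, OF per] \<mu> by (metis mult_eq_0_iff divide_eq_0_iff zero_neq_one)
  moreover have "u \<noteq> (\<lambda>_. 0)"
  proof
    assume "u = (\<lambda>_. 0)"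
    with xu have "x = 0\<^sub>v k" by (auto intro!: eq_vecI)
    with x(2) show False by simp
  qed
  ultimately show ?thesis using that per by blast
qed

end

subsection \<open>The Fredholm determinant\<close>

lemma integral_geometric_cis:
  fixes c :: complex and s :: int
  assumes c: "norm c < 1" and s: "s \<noteq> 0"
  shows "((\<lambda>t. 1 / (1 - c * cis (of_int s * t))) has_integral of_real (2 * pi)) {0..2 * pi}"
proof -
  define f where "f = (\<lambda>t. 1 / (1 - c * cis (of_int s * t)))"
  have ne: "1 - c * cis (of_int s * t) \<noteq> 0" for t
  proof
    assume "1 - c * cis (of_int s * t) = 0"
    then have "norm (c * cis (of_int s * t)) = norm (1 :: complex)" by simp
    then show False using c by (simp add: norm_mult)
  qed
  have "continuous_on {0..2 * pi} f"
    unfolding f_def using ne by (intro continuous_intros) auto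
  then have int: "f integrable_on {0..2 * pi}" by (rule integrable_continuous_real)
  have bound: "norm (f t) \<le> 1 / (1 - norm c)" for t
  proof -
    have "1 - norm c \<le> norm (1 - c * cis (of_int s * t))"
      using norm_triangle_ineq2[of 1 "c * cis (of_int s * t)"] by (simp add: norm_mult)
    then show ?thesis unfolding f_def using c by (simp add: norm_divide frac_le)
  qed
  \<comment> \<open>The geometric series is cut after the power \<open>N\<close>. Only its constant
    term has a nonzero integral, and the remainder is bounded uniformly in \<open>t\<close>.\<close>
  have est: "norm (integral {0..2 * pi} f - of_real (2 * pi)) \<le> 1 / (1 - norm c) * (2 * pi) * norm c ^ Suc N" for N
  proof -
    let ?g = "\<lambda>t. (\<Sum>j<Suc N. c ^ j * cis (of_int (int j * s) * t))"
    have pow: "(c * cis (of_int s * t)) ^ j = c ^ j * cis (of_int (int j * s) * t)" for j t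
      by (simp add: power_mult_distrib Complex.DeMoivre mult_ac)
    have diff: "f t - ?g t = (c * cis (of_int s * t)) ^ Suc N * f t" for t
    proof -
      let ?w = "c * cis (of_int s * t)"
      have "?g t = (1 - ?w ^ Suc N) / (1 - ?w)"
        unfolding pow[symmetric] using ne[of t] by (subst sum_gp_strict) auto
      then show ?thesis by (simp add: f_def diff_divide_distrib)
    qed
    have "(?g has_integral (\<Sum>j<Suc N. c ^ j * (if int j * s = 0 then of_real (2 * pi) else 0))) {0..2 * pi}"
      by (intro has_integral_sum has_integral_mult_right has_integral_cis_period) auto
    also have "(\<Sum>j<Suc N. c ^ j * (if int j * s = 0 then of_real (2 * pi) else 0)) = (of_real (2 * pi) :: complex)"
      using s by (subst sum.lessThan_Suc_shift) simp
    finally have "((\<lambda>t. f t - ?g t) has_integral integral {0..2 * pi} f - of_real (2 * pi)) {0..2 * pi}"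
      by (intro has_integral_diff integrable_integral int)
    moreover have "norm (f t - ?g t) \<le> norm c ^ Suc N * (1 / (1 - norm c))" for t
      unfolding diff norm_mult norm_power using bound[of t] by (intro mult_mono) auto
    moreover have "0 \<le> norm c ^ Suc N * (1 / (1 - norm c))" using c by simp
    ultimately have "norm (integral {0..2 * pi} f - of_real (2 * pi))
        \<le> norm c ^ Suc N * (1 / (1 - norm c)) * Henstock_Kurzweil_Integration.content {0..2 * pi}"
      using has_integral_bound_real by blast
    then show ?thesis by (simp add: mult_ac)
  qed
  have "(\<lambda>N. 1 / (1 - norm c) * (2 * pi) * norm c ^ Suc N) \<longlonglongrightarrow> 1 / (1 - norm c) * (2 * pi) * 0"
    by (intro tendsto_mult tendsto_const LIMSEQ_Suc LIMSEQ_power_zero) (use c in simp)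
  with est have "norm (integral {0..2 * pi} f - of_real (2 * pi)) \<le> 1 / (1 - norm c) * (2 * pi) * 0"
    by (intro LIMSEQ_le_const) auto
  then have "integral {0..2 * pi} f = of_real (2 * pi)" by simp
  with int show ?thesis unfolding f_def by (metis integrable_integral)
qed

lemma fourier_coeff_cong:
  assumes "\<And>t. g (cis t) = h (cis t)"
  shows "fourier_coeff g = fourier_coeff h"
  by (simp add: fourier_coeff_def assms fun_eq_iff)

text \<open>The exponential of index \<open>1\<close> cancels the numerator and leaves the mean of
  1/(\<beta> (1 - \<mu> z)) over the circle, which depends on whether the pole 1/\<mu> lies outside
  or inside.\<close>

lemma fourier_coeff_pole:
  assumes \<beta>: "\<beta> \<noteq> 0" and \<mu>: "norm \<mu> \<noteq> 1" and h: "\<And>t. h (cis t) = cis t / (\<beta> * (1 - \<mu> * cis t))"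
  shows "fourier_coeff h 1 = (if norm \<mu> < 1 then 1 / \<beta> else 0)"
proof -
  have "((\<lambda>t. 1 / (1 - \<mu> * cis t)) has_integral (if norm \<mu> < 1 then of_real (2 * pi) else 0)) {0..2 * pi}"
  proof (cases "norm \<mu> < 1")
    case True
    then show ?thesis using integral_geometric_cis[of \<mu> 1] by simp
  next
    case False
    then have "norm \<mu> > 1" using \<mu> by simp
    then have inv: "norm (1 / \<mu>) < 1" and \<mu>0: "\<mu> \<noteq> 0" by (auto simp: norm_divide divide_less_eq)
    \<comment> \<open>Passing to powers of 1/(\<mu> z) restores a convergent geometric series, whose
      mean \<open>1\<close> cancels the constant.\<close>
    have eq: "1 / (1 - \<mu> * cis t) = 1 - 1 / (1 - 1 / \<mu> * cis (of_int (- 1) * t))" for t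
    proof -
      define w where "w = \<mu> * cis t"
      have w: "norm w = norm \<mu>" by (simp add: w_def norm_mult)
      have "w \<noteq> 0" "w \<noteq> 1" using w \<mu> \<mu>0 by auto
      then have "1 / (1 - w) = 1 - 1 / (1 - 1 / w)"
        by (simp add: field_simps)
      moreover have "1 / \<mu> * cis (of_int (- 1) * t) = 1 / w"
        by (simp add: w_def divide_inverse cis_inverse)
      ultimately show ?thesis by (simp add: w_def)
    qed
    have "((\<lambda>t. 1 - 1 / (1 - 1 / \<mu> * cis (of_int (- 1) * t))) has_integral of_real (2 * pi) - of_real (2 * pi)) {0..2 * pi}"
      using has_integral_cis_period[of 0] by (intro has_integral_diff integral_geometric_cis inv) auto
    then show ?thesis unfolding eq using False by simp
  qed
  then have "((\<lambda>t. 1 / \<beta> * (1 / (1 - \<mu> * cis t))) has_integral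
      (1 / \<beta> * (if norm \<mu> < 1 then of_real (2 * pi) else 0))) {0..2 * pi}"
    by (rule has_integral_mult_right)
  moreover have "h (cis t) * cis (- (of_int 1 * t)) = 1 / \<beta> * (1 / (1 - \<mu> * cis t))" for t
  proof -
    have "cis (- (of_int 1 * t)) = 1 / cis t"
      by (simp add: divide_inverse cis_inverse)
    then show ?thesis by (simp add: h)
  qed
  ultimately have "((\<lambda>t. h (cis t) * cis (- (of_int 1 * t))) has_integral
      (1 / \<beta> * (if norm \<mu> < 1 then of_real (2 * pi) else 0))) {0..2 * pi}"
    by simp
  from integral_unique[OF this] show ?thesis by (simp add: fourier_coeff_def)
qed

lemma fourier_coeff_cmult: "fourier_coeff (\<lambda>z. c * h z) n = c * fourier_coeff h n"
  by (simp add: fourier_coeff_def mult.assoc)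

lemma fourier_coeff_mult_cis: "fourier_coeff (\<lambda>z. z * h z) n = fourier_coeff h (n - 1)"
proof -
  have "cis t * h (cis t) * cis (- (of_int n * t)) = h (cis t) * cis (- (of_int (n - 1) * t))" for t
  proof -
    have "cis t * cis (- (of_int n * t)) = cis (- (of_int (n - 1) * t))"
      by (simp add: cis_mult algebra_simps)
    then show ?thesis by (simp add: mult_ac)
  qed
  then show ?thesis by (simp only: fourier_coeff_def)
qed

lemma fourier_coeff_div_cis: "fourier_coeff (\<lambda>z. h z / z) n = fourier_coeff h (n + 1)"
proof -
  have "fourier_coeff (\<lambda>z. z * (h z / z)) (n + 1) = fourier_coeff h (n + 1)"
    by (subst fourier_coeff_cong[of _ h]) auto
  then show ?thesis unfolding fourier_coeff_mult_cis by simp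
qed

lemma fourier_integrable:
  assumes "continuous_on {0..2 * pi} (\<lambda>t. h (cis t))"
  shows "(\<lambda>t. h (cis t) * cis (- (of_int n * t))) integrable_on {0..2 * pi}"
  by (intro integrable_continuous_real continuous_intros assms)

lemma fourier_coeff_add:
  assumes "continuous_on {0..2 * pi} (\<lambda>t. g (cis t))" "continuous_on {0..2 * pi} (\<lambda>t. h (cis t))"
  shows "fourier_coeff (\<lambda>z. g z + h z) n = fourier_coeff g n + fourier_coeff h n"
  unfolding fourier_coeff_def distrib_right
  by (subst Henstock_Kurzweil_Integration.integral_add)
     (use assms in \<open>auto intro: fourier_integrable simp: add_divide_distrib\<close>)

lemma fourier_coeff_sum:
  assumes "finite I" "\<And>i. i \<in> I \<Longrightarrow> continuous_on {0..2 * pi} (\<lambda>t. h i (cis t))"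
  shows "fourier_coeff (\<lambda>z. \<Sum>i\<in>I. h i z) n = (\<Sum>i\<in>I. fourier_coeff (h i) n)"
  unfolding fourier_coeff_def sum_distrib_right
  by (subst integral_sum) (use assms in \<open>auto intro: fourier_integrable simp: sum_divide_distrib\<close>)

section \<open>Continuity and the inverse matrix\<close>

lemma continuous_on_det:
  fixes N :: "'a :: topological_space \<Rightarrow> complex mat"
  assumes "\<And>t. N t \<in> carrier_mat n n"
    and "\<And>i j. i < n \<Longrightarrow> j < n \<Longrightarrow> continuous_on S (\<lambda>t. N t $$ (i, j))"
  shows "continuous_on S (\<lambda>t. Determinant.det (N t))"
proof -
  have "continuous_on S (\<lambda>t. \<Sum>p\<in>{p. p permutes {0..<n}}. signof p * (\<Prod>i = 0..<n. N t $$ (i, p i)))"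
    by (intro continuous_on_sum continuous_on_mult continuous_on_const continuous_on_prod assms(2))
       (auto dest: permutes_in_image)
  then show ?thesis by (simp add: det_def'[OF assms(1)])
qed

lemma continuous_on_cofactor:
  fixes N :: "'a :: topological_space \<Rightarrow> complex mat"
  assumes "\<And>t. N t \<in> carrier_mat n n"
    and "\<And>i j. i < n \<Longrightarrow> j < n \<Longrightarrow> continuous_on S (\<lambda>t. N t $$ (i, j))"
  shows "continuous_on S (\<lambda>t. cofactor (N t) r c)"
  unfolding cofactor_def
proof (intro continuous_on_mult continuous_on_const continuous_on_det)
  show "mat_delete (N t) r c \<in> carrier_mat (n - 1) (n - 1)" for t
    by (rule mat_delete_carrier[OF assms(1)])
  show "continuous_on S (\<lambda>t. mat_delete (N t) r c $$ (i, j))" if "i < n - 1" "j < n - 1" for i j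
    using that assms(1)[THEN carrier_matD(1)] assms(1)[THEN carrier_matD(2)]
    by (simp add: mat_delete_def) (auto intro!: assms(2))
qed

text \<open>The cofactor formula makes the dependence on the entries explicit, which yields
  continuity of the inverse symbol along the circle.\<close>

lemma mat_inverse_cofactor:
  fixes M :: "'a :: field mat"
  assumes M: "M \<in> carrier_mat n n" and det: "Determinant.det M \<noteq> 0"
  shows "the (mat_inverse M) \<in> carrier_mat n n" "the (mat_inverse M) * M = 1\<^sub>m n"
    and "\<And>i j. i < n \<Longrightarrow> j < n \<Longrightarrow> the (mat_inverse M) $$ (i, j) = cofactor M j i / Determinant.det M"
proof -
  have "mat_inverse M \<noteq> None"
    using mat_inverse(1)[OF M, where b = "()"] det_non_zero_imp_unit[OF M det, where b = "()"] by blast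
  then obtain R where R: "mat_inverse M = Some R" by blast
  from mat_inverse(2)[OF M R] have RM: "R * M = 1\<^sub>m n" and Rc: "R \<in> carrier_mat n n" by auto
  show "the (mat_inverse M) \<in> carrier_mat n n" "the (mat_inverse M) * M = 1\<^sub>m n"
    using R RM Rc by auto
  note adj = adj_mat[OF M]
  have "adj_mat M = R * M * adj_mat M" using RM adj(1) by simp
  also have "\<dots> = R * (M * adj_mat M)" by (rule assoc_mult_mat[OF Rc M adj(1)])
  also have "\<dots> = Determinant.det M \<cdot>\<^sub>m R"
    unfolding adj(2) using Rc by (simp add: mult_smult_distrib[OF Rc one_carrier_mat])
  finally have eq: "adj_mat M = Determinant.det M \<cdot>\<^sub>m R" .
  fix i j assume "i < n" "j < n"
  then have "cofactor M j i = Determinant.det M * R $$ (i, j)"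
    using arg_cong[OF eq, of "\<lambda>X. X $$ (i, j)"] M Rc by (simp add: adj_mat_def)
  then show "the (mat_inverse M) $$ (i, j) = cofactor M j i / Determinant.det M"
    using det R by simp
qed

text \<open>Off its zeroth column \<open>A\<close> is the identity, so only the index sets \<open>{}\<close> and \<open>{0}\<close> contribute.\<close>

lemma fredholm_det_column:
  assumes A: "\<And>i j. j > 0 \<Longrightarrow> entry A i j = (if i = j then 1 else 0)"
  shows "fredholm_det A = entry A 0 0"
proof -
  define K where "K = (\<lambda>i j. entry A i j - (if i = j then 1 else 0))"
  have K: "K i j = 0" if "j > 0" for i j using A[OF that] by (simp add: K_def)
  define d where "d = (\<lambda>n S. Determinant.det (mat n n (\<lambda>(p, q).
          K (sorted_list_of_set S ! p) (sorted_list_of_set S ! q))))"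
  define F where "F = (\<lambda>n. \<Sum>\<^sub>\<infinity>S\<in>{S. finite S \<and> card S = n}. d n S)"
  have F0: "F 0 = 1"
  proof -
    have "{S :: nat set. finite S \<and> card S = 0} = {{}}" by auto
    then show ?thesis by (simp add: F_def d_def)
  qed
  have F1: "F 1 = K 0 0"
  proof -
    have "F 1 = (\<Sum>\<^sub>\<infinity>S\<in>{{0}}. d 1 S)"
      unfolding F_def
    proof (rule infsum_cong_neutral)
      fix S :: "nat set" assume "S \<in> {S. finite S \<and> card S = 1} - {{0}}"
      then obtain i where "S = {i}" "i \<noteq> 0" by (auto simp: card_1_singleton_iff)
      then show "d 1 S = 0" by (simp add: d_def K det_single)
    qed auto
    then show ?thesis by (simp add: d_def det_single)
  qed
  \<comment> \<open>The largest index of such a set is positive, and its column in the minor is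
    zero.\<close>
  have F2: "F n = 0" if n: "n \<ge> 2" for n
    unfolding F_def
  proof (rule infsum_0)
    fix S :: "nat set" assume "S \<in> {S. finite S \<and> card S = n}"
    then have S: "finite S" "card S = n" by auto
    have "sorted_list_of_set S ! 0 < sorted_list_of_set S ! (n - 1)"
      using S n by (intro sorted_wrt_nth_less[OF strict_sorted_list_of_set]) auto
    then have "K i (sorted_list_of_set S ! (n - 1)) = 0" for i by (intro K) simp
    then show "d n S = 0"
      unfolding d_def using n by (subst laplace_expansion_column[where j = "n - 1" and n = n]) auto
  qed
  have "fredholm_det A = (\<Sum>n. F n)"
    by (simp add: fredholm_det_def F_def d_def K_def Let_def)
  also have "\<dots> = (\<Sum>n\<in>{0, 1}. F n)"
    by (rule suminf_finite) (use F2 in auto)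
  also have "\<dots> = entry A 0 0" using F0 F1 by (simp add: K_def)
  finally show ?thesis .
qed

section \<open>The product of the two block Toeplitz operators\<close>

context tridiagonal_toeplitz
begin

lemma A_add_periods [simp]: "A (n + m * k) = A n" and B_add_periods [simp]: "B (n + m * k) = B n"
  by (simp_all add: A_def B_def)

lemma band_shift: "band (i + m * k) (j + m * k) = band i j"
  using A_add_periods[of i m] B_add_periods[of i m] B_add_periods[of j m] by (simp add: band_def)

lemma block_toeplitz_shifted_symbol: "block_toeplitz k (shifted_symbol k a b lam) p q = band p q"
proof -
  have "shifted_symbol k a b lam = symbol k (\<lambda>i. a i - lam) b"
    by (intro ext eq_matI)
       (auto simp: shifted_symbol_def symbol_def A_minus_def A_plus_def A_zero_def tridiag_def)
  then have "block_toeplitz k (shifted_symbol k a b lam) p q = tridiag k (\<lambda>i. a i - lam) b p q"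
    by (simp add: block_toeplitz_symbol[OF k_pos])
  then show ?thesis by (simp add: tridiag_def band_def A_def B_def)
qed

text \<open>Column \<open>j\<close> of the band matrix has finite support, so the series is a finite
  sum. For \<open>j = 0\<close> the range is \<open>{0..1}\<close>: the left neighbour is
  missing.\<close>

lemma entry_comp_toeplitz:
  "entry (op_of R \<circ> op_of (block_toeplitz k (shifted_symbol k a b lam))) i j
     = (\<Sum>m\<in>{j - 1..Suc j}. R i m * band m j)"
proof -
  have "op_of (block_toeplitz k (shifted_symbol k a b lam)) (unit_seq j) = (\<lambda>m. band m j)"
  proof
    fix m
    have "(\<Sum>l. band m l * unit_seq j l) = (\<Sum>l\<in>{j}. band m l * unit_seq j l)"
      by (rule suminf_finite) (auto simp: unit_seq_def)
    then show "op_of (block_toeplitz k (shifted_symbol k a b lam)) (unit_seq j) m = band m j"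
      by (simp add: op_of_def block_toeplitz_shifted_symbol unit_seq_def)
  qed
  moreover have "(\<Sum>m. R i m * band m j) = (\<Sum>m\<in>{j - 1..Suc j}. R i m * band m j)"
    by (rule suminf_finite) (auto simp: band_def)
  ultimately show ?thesis by (simp add: entry_def op_of_def)
qed

lemma shifted_symbol_continuous:
  assumes "i < k" "j < k"
  shows "continuous_on S (\<lambda>t. shifted_symbol k a b lam (cis t) $$ (i, j))"
proof -
  have "shifted_symbol k a b lam (cis t) $$ (i, j) = (tridiag k a b i j - (if i = j then lam else 0))
     + (if i = 0 \<and> j = k - 1 then B (k - 1) else 0) * cis t
     + (if i = k - 1 \<and> j = 0 then B (k - 1) else 0) / cis t" for t
    unfolding shifted_symbol_entry[OF assms] by simp
  then show ?thesis by (auto intro!: continuous_intros simp del: cis_divide)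
qed

lemma inverse_symbol_continuous:
  assumes det: "\<And>t. Determinant.det (shifted_symbol k a b lam (cis t)) \<noteq> 0" and ij: "i < k" "j < k"
  shows "continuous_on S (\<lambda>t. inverse_symbol k a b lam (cis t) $$ (i, j))"
  unfolding inverse_symbol_def mat_inverse_cofactor(3)[OF shifted_symbol_carrier det ij]
  by (intro continuous_on_divide continuous_on_cofactor continuous_on_det ballI
        shifted_symbol_continuous det) simp_all

text \<open>The Fourier coefficients of the identity "inverse symbol times symbol is
  \<open>Id\<close>" at entry \<open>(i, j)\<close>. The corners carry factors z and 1/z, which
  shift the index by one.\<close>

lemma inverse_symbol_fourier:
  assumes det: "\<And>t. Determinant.det (shifted_symbol k a b lam (cis t)) \<noteq> 0" and ij: "i < k" "j < k"
  defines "\<rho> \<equiv> \<lambda>l. fourier_coeff (\<lambda>z. inverse_symbol k a b lam z $$ (i, l))"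
  shows "(\<Sum>l<k. band l j * \<rho> l n) + (if j = k - 1 then B (k - 1) * \<rho> 0 (n - 1) else 0)
      + (if j = 0 then B (k - 1) * \<rho> (k - 1) (n + 1) else 0) = (if i = j \<and> n = 0 then 1 else 0)"
proof -
  define R where "R = inverse_symbol k a b lam"
  have cont: "continuous_on {0..2 * pi} (\<lambda>t. R (cis t) $$ (i, l))" if "l < k" for l
    unfolding R_def by (rule inverse_symbol_continuous[OF det ij(1) that])
  have k0: "0 < k" "k - 1 < k" using k_pos by auto
  define g1 where "g1 = (\<lambda>z. \<Sum>l<k. band l j * R z $$ (i, l))"
  define g2 where "g2 = (\<lambda>z. (if j = k - 1 then B (k - 1) else 0) * (z * R z $$ (i, 0)))"
  define g3 where "g3 = (\<lambda>z. (if j = 0 then B (k - 1) else 0) * (R z $$ (i, k - 1) / z))"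
  have c: "continuous_on {0..2 * pi} (\<lambda>t. g1 (cis t))" "continuous_on {0..2 * pi} (\<lambda>t. g2 (cis t))"
      "continuous_on {0..2 * pi} (\<lambda>t. g3 (cis t))"
    unfolding g1_def g2_def g3_def by (intro continuous_intros cont k0; simp)+
  have f1: "fourier_coeff g1 n = (\<Sum>l<k. band l j * \<rho> l n)"
    unfolding g1_def \<rho>_def R_def[symmetric]
    by (subst fourier_coeff_sum) (auto intro!: continuous_intros cont simp: fourier_coeff_cmult)
  have f23: "fourier_coeff g2 n = (if j = k - 1 then B (k - 1) else 0) * \<rho> 0 (n - 1)"
      "fourier_coeff g3 n = (if j = 0 then B (k - 1) else 0) * \<rho> (k - 1) (n + 1)"
    unfolding g2_def g3_def \<rho>_def R_def[symmetric] fourier_coeff_cmult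
      fourier_coeff_mult_cis fourier_coeff_div_cis by simp_all
  have pointwise: "g1 (cis t) + g2 (cis t) + g3 (cis t) = (if i = j then 1 else 0)" for t
  proof -
    let ?z = "cis t"
    note inv = mat_inverse_cofactor(1,2)[OF shifted_symbol_carrier det, folded inverse_symbol_def R_def]
    have "(if i = j then 1 else 0) = (R ?z * shifted_symbol k a b lam ?z) $$ (i, j)"
      unfolding inv(2) using ij by simp
    also have "\<dots> = (\<Sum>l<k. R ?z $$ (i, l) * shifted_symbol k a b lam ?z $$ (l, j))"
      using ij carrier_matD[OF inv(1)[of t]] carrier_matD[OF shifted_symbol_carrier[of ?z]]
      by (simp add: scalar_prod_def lessThan_atLeast0 Matrix.row_def)
    also have "\<dots> = (\<Sum>l<k. band l j * R ?z $$ (i, l)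
        + (if l = 0 then (if j = k - 1 then B (k - 1) else 0) * (?z * R ?z $$ (i, 0)) else 0)
        + (if l = k - 1 then (if j = 0 then B (k - 1) else 0) * (R ?z $$ (i, k - 1) / ?z) else 0))"
    proof (rule sum.cong)
      fix l assume "l \<in> {..<k}"
      then have l: "l < k" by simp
      show "R ?z $$ (i, l) * shifted_symbol k a b lam ?z $$ (l, j) = band l j * R ?z $$ (i, l)
        + (if l = 0 then (if j = k - 1 then B (k - 1) else 0) * (?z * R ?z $$ (i, 0)) else 0)
        + (if l = k - 1 then (if j = 0 then B (k - 1) else 0) * (R ?z $$ (i, k - 1) / ?z) else 0)"
        unfolding shifted_symbol_entry[OF l ij(2)] tridiag_band
        by (cases "l = 0"; cases "l = k - 1"; cases "j = 0"; cases "j = k - 1") (simp_all add: algebra_simps)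
    qed simp
    also have "\<dots> = g1 ?z + g2 ?z + g3 ?z"
      unfolding g1_def g2_def g3_def sum.distrib using k0 by simp
    finally show ?thesis by simp
  qed
  have "fourier_coeff g1 n + fourier_coeff g2 n + fourier_coeff g3 n = fourier_coeff (\<lambda>z. g1 z + g2 z + g3 z) n"
    using fourier_coeff_add[OF continuous_on_add[OF c(1,2)] c(3)] fourier_coeff_add[OF c(1,2)] by simp
  also have "\<dots> = (if i = j \<and> n = 0 then 1 else 0)"
    by (subst fourier_coeff_laurent[where u = 0 and w = 0 and v = "if i = j then 1 else 0"])
       (auto simp: pointwise)
  finally have "fourier_coeff g1 n + fourier_coeff g2 n + fourier_coeff g3 n
      = (if i = j \<and> n = 0 then 1 else 0)" .
  moreover have "(if c then x else 0) * y = (if c then x * y else 0)" for c and x y :: complex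
    by simp
  ultimately show ?thesis unfolding f1 f23 by (simp only:)
qed

text \<open>Over all integers the convolution would give the identity. The half-line omits the index
  just before \<open>0\<close>, which meets the band only in column \<open>0\<close>; it is position
  \<open>k - 1\<close> of block -1, whence the Fourier index
  \<open>int (p div k) + 1\<close>.\<close>

lemma entry_inverse_comp:
  assumes det: "\<And>t. Determinant.det (shifted_symbol k a b lam (cis t)) \<noteq> 0"
  shows "entry (op_of (block_toeplitz k (inverse_symbol k a b lam)) \<circ>
      op_of (block_toeplitz k (shifted_symbol k a b lam))) p j
    = (if p = j then 1 else 0) - (if j = 0 then B (k - 1) *
        fourier_coeff (\<lambda>z. inverse_symbol k a b lam z $$ (p mod k, k - 1)) (int (p div k) + 1) else 0)"
proof -
  define E where "E = entry (op_of (block_toeplitz k (inverse_symbol k a b lam)) \<circ>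
      op_of (block_toeplitz k (shifted_symbol k a b lam))) p j"
  define i P j' Q where defs: "i = p mod k" "P = p div k" "j' = j mod k" "Q = j div k"
  define n where "n = int P - int Q"
  define \<rho> where "\<rho> = (\<lambda>l. fourier_coeff (\<lambda>z. inverse_symbol k a b lam z $$ (i, l)))"
  have k0: "0 < k" "k - 1 < k" using k_pos by auto
  have ij: "i < k" "j' < k" using k0 by (auto simp: defs)
  have j: "j = j' + Q * k" and p: "p = i + P * k" by (auto simp: defs)
  define F where "F = (\<lambda>m. block_toeplitz k (inverse_symbol k a b lam) p m * band m j)"
  have F: "F m = \<rho> (m mod k) (int P - int (m div k)) * band m j" for m
    by (simp add: F_def block_toeplitz_def \<rho>_def defs)
  have mid: "F (l + Q * k) = band l j' * \<rho> l n" if "l < k" for l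
    unfolding F j band_shift using that by (simp add: n_def)
  have top: "F (k + Q * k) = (if j' = k - 1 then B (k - 1) * \<rho> 0 (n - 1) else 0)"
    unfolding F j band_shift using ij k0 by (auto simp: band_def n_def algebra_simps)
  have bot: "F (Q * k - 1) = (if j' = 0 then B (k - 1) * \<rho> (k - 1) (n + 1) else 0)" if Q_pos: "Q > 0"
  proof -
    obtain q where q: "Q = Suc q" using Q_pos by (cases Q) auto
    have 1: "Q * k - 1 = (k - 1) + q * k" using q k0 by simp
    have 2: "j = (j' + k) + q * k" using j q by simp
    have 3: "(l + q * k) mod k = l" "(l + q * k) div k = q" if "l < k" for l
      using that by simp_all
    show ?thesis unfolding 1 F 3[OF k0(2)] 2 band_shift using ij k0 by (auto simp: band_def n_def q algebra_simps)
  qed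
  \<comment> \<open>The range is widened to the whole block \<open>Q\<close> and one index on either
    side; the band vanishes on what is added.\<close>
  have "(\<Sum>m\<in>{j - 1..Suc j}. F m) = (\<Sum>m\<in>{Q * k - 1..Q * k + k}. F m)"
    by (rule sum.mono_neutral_left) (use ij j in \<open>auto simp: F_def band_def\<close>)
  \<comment> \<open>For \<open>Q = 0\<close> the lower end \<open>Q * k - 1\<close> is
    \<open>0\<close> by truncated subtraction, so there is no index to the left of the
    block.\<close>
  also have "\<dots> = (if Q > 0 then F (Q * k - 1) else 0) + (\<Sum>m\<in>{Q * k..<Q * k + k}. F m) + F (k + Q * k)"
  proof (cases "Q > 0")
    case True
    have "{N - 1..N + k} = insert (N - 1) (insert (k + N) {N..<N + k})"
        "N - 1 \<noteq> k + N" "N - 1 \<notin> {N..<N + k}" if "N > 0" for N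
      using that by auto
    from this[of "Q * k"] True k0
    have "{Q * k - 1..Q * k + k} = insert (Q * k - 1) (insert (k + Q * k) {Q * k..<Q * k + k})"
        "Q * k - 1 \<noteq> k + Q * k" "Q * k - 1 \<notin> {Q * k..<Q * k + k}" by auto
    then show ?thesis using True by (simp add: add_ac)
  next
    case False
    then show ?thesis by (simp add: atLeast0AtMost lessThan_Suc_atMost[symmetric] lessThan_atLeast0)
  qed
  also have "(\<Sum>m\<in>{Q * k..<Q * k + k}. F m) = (\<Sum>l<k. band l j' * \<rho> l n)"
    using sum.shift_bounds_nat_ivl[of F 0 "Q * k" k] mid by (simp add: lessThan_atLeast0 add.commute)
  finally have "E
     = (if Q > 0 then F (Q * k - 1) else 0) + (\<Sum>l<k. band l j' * \<rho> l n) + F (k + Q * k)"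
    by (simp only: E_def entry_comp_toeplitz F_def)
  also have "\<dots> = (if i = j' \<and> n = 0 then 1 else 0)
      - (if j' = 0 \<and> Q = 0 then B (k - 1) * \<rho> (k - 1) (n + 1) else 0)"
  proof -
    have "(\<Sum>l<k. band l j' * \<rho> l n) + (if j' = k - 1 then B (k - 1) * \<rho> 0 (n - 1) else 0)
      + (if j' = 0 then B (k - 1) * \<rho> (k - 1) (n + 1) else 0) = (if i = j' \<and> n = 0 then 1 else 0)"
      unfolding \<rho>_def by (rule inverse_symbol_fourier[OF det ij])
    then show ?thesis
      unfolding top by (cases "Q > 0") (simp_all only: bot, simp_all add: algebra_simps)
  qed
  also have "i = j' \<and> n = 0 \<longleftrightarrow> p = j"
  proof -
    have "p = j" if "p mod k = j mod k" "p div k = j div k"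
      using that by (metis div_mult_mod_eq)
    then show ?thesis by (auto simp: n_def defs)
  qed
  also have "j' = 0 \<and> Q = 0 \<longleftrightarrow> j = 0"
    using j k0 by auto
  finally show ?thesis unfolding E_def[symmetric] by (auto simp: \<rho>_def defs n_def)
qed

lemma C_zero_eq:
  assumes det: "\<And>t. Determinant.det (shifted_symbol k a b lam (cis t)) \<noteq> 0"
  shows "C_zero k a b lam
    = 1 - B (k - 1) * fourier_coeff (\<lambda>z. inverse_symbol k a b lam z $$ (0, k - 1)) 1"
  unfolding C_zero_def
  by (subst fredholm_det_column) (simp_all add: entry_inverse_comp[OF det])

lemma bloch_det_nonzero:
  assumes bloch: "bloch \<mu> v" and \<mu>: "norm \<mu> \<noteq> 1"
  shows "Determinant.det (shifted_symbol k a b lam (cis t)) \<noteq> 0"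
proof -
  obtain q where q: "q \<noteq> 0" and det:
    "\<And>z. z \<noteq> 0 \<Longrightarrow> z * Determinant.det (shifted_symbol k a b lam z) = q * (z - \<mu>) * (z - 1 / \<mu>)"
    using bloch_symbol_det[OF bloch] by blast
  have "cis t \<noteq> \<mu>" using \<mu> by auto
  moreover have "cis t \<noteq> 1 / \<mu>"
  proof
    assume "cis t = 1 / \<mu>"
    then have "norm (1 / \<mu>) = 1" by (metis norm_cis)
    then show False using \<mu> by (simp add: norm_divide)
  qed
  ultimately show ?thesis using det[of "cis t"] q by auto
qed

text \<open>The restriction \<open>x\<close> of \<open>v\<close> to one period satisfies
  \<open>(f z - \<lambda>) x = b\<^sub>k x\<^sub>1 (1/z - \<mu>) e\<^sub>k\<close>, which reads off the corner of the inverse symbol.\<close>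

lemma bloch_inverse_symbol:
  assumes bloch: "bloch \<mu> v" and \<mu>: "norm \<mu> \<noteq> 1"
  shows "inverse_symbol k a b lam (cis t) $$ (0, k - 1) = cis t / (B (k - 1) * (1 - \<mu> * cis t))"
proof -
  let ?z = "cis t" and ?x = "Matrix.vec k v"
  from bloch have v0: "v 0 \<noteq> 0" and vk: "v (k - 1) = 0" and per: "\<And>n. v (n + k) = \<mu> * v n"
    and row: "\<And>n. local.row v n = 0"
    by (auto simp: bloch_def)
  have k1: "k - 1 \<noteq> 0" using v0 vk by (cases "k - 1 = 0") auto
  note inv = mat_inverse_cofactor(1,2)[OF shifted_symbol_carrier bloch_det_nonzero[OF assms, of t],
      folded inverse_symbol_def]
  \<comment> \<open>In the last row the symbol has \<open>v 0 / ?z\<close> where the recurrence has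
    \<open>v k = \<mu> * v 0\<close>; \<open>c\<close> is the discrepancy.\<close>
  define c where "c = B (k - 1) * v 0 * (1 / ?z - \<mu>)"
  have Mx: "shifted_symbol k a b lam ?z *\<^sub>v ?x = c \<cdot>\<^sub>v unit_vec k (k - 1)"
  proof (rule eq_vecI)
    fix i assume "i < dim_vec (c \<cdot>\<^sub>v unit_vec k (k - 1))"
    then have i: "i < k" by simp
    show "(shifted_symbol k a b lam ?z *\<^sub>v ?x) $ i = (c \<cdot>\<^sub>v unit_vec k (k - 1)) $ i"
    proof (cases "i = k - 1")
      case True
      have "Suc (k - 1) = k" using k1 by simp
      then have "v (Suc i) = \<mu> * v 0" using per[of 0] True by simp
      then show ?thesis
        unfolding symbol_mult_vec[OF i] using True k1 i vk row[of i]
        by (simp add: local.row_def c_def algebra_simps)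
    next
      case False
      then show ?thesis
        unfolding symbol_mult_vec[OF i] using k1 i vk row[of i]
        by (auto simp: local.row_def split: if_splits)
    qed
  qed (simp add: shifted_symbol_pencil pencil_def)
  have "?x = (inverse_symbol k a b lam ?z * shifted_symbol k a b lam ?z) *\<^sub>v ?x"
    unfolding inv(2) by simp
  also have "\<dots> = inverse_symbol k a b lam ?z *\<^sub>v (c \<cdot>\<^sub>v unit_vec k (k - 1))"
    unfolding Mx[symmetric] by (rule assoc_mult_mat_vec[OF inv(1) shifted_symbol_carrier]) simp
  finally have "?x $ 0 = (inverse_symbol k a b lam ?z *\<^sub>v (c \<cdot>\<^sub>v unit_vec k (k - 1))) $ 0" by simp
  also have "\<dots> = c * inverse_symbol k a b lam ?z $$ (0, k - 1)"
    using k_pos k1 carrier_matD[OF inv(1)] by simp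
  finally have eq: "v 0 = c * inverse_symbol k a b lam ?z $$ (0, k - 1)" using k_pos by simp
  with v0 have "c \<noteq> 0" by auto
  have "?z * c = B (k - 1) * (1 - \<mu> * ?z) * v 0"
    by (simp add: c_def algebra_simps)
  then have "c * ?z = c * (B (k - 1) * (1 - \<mu> * ?z) * inverse_symbol k a b lam ?z $$ (0, k - 1))"
    using eq by (simp add: mult_ac)
  then have eq': "B (k - 1) * (1 - \<mu> * ?z) * inverse_symbol k a b lam ?z $$ (0, k - 1) = ?z"
    using \<open>c \<noteq> 0\<close> by simp
  then have "B (k - 1) * (1 - \<mu> * ?z) \<noteq> 0" by (metis cis_neq_zero mult_zero_left)
  then show ?thesis using eq' by (metis nonzero_mult_div_cancel_left)
qed

lemma bloch_C_zero:
  assumes "bloch \<mu> v" and "norm \<mu> \<noteq> 1"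
  shows "C_zero k a b lam = (if norm \<mu> < 1 then 0 else 1)"
proof -
  have "fourier_coeff (\<lambda>z. inverse_symbol k a b lam z $$ (0, k - 1)) 1
      = (if norm \<mu> < 1 then 1 / B (k - 1) else 0)"
    by (rule fourier_coeff_pole[OF B_nonzero assms(2) bloch_inverse_symbol[OF assms]])
  then show ?thesis by (simp add: C_zero_eq bloch_det_nonzero[OF assms])
qed

end

subsection \<open>The Fredholm property\<close>

lemma ell2_dominated:
  assumes "summable g" "\<And>n. (norm (x n))\<^sup>2 \<le> g n"
  shows "x \<in> ell2"
  unfolding ell2_def using assms by (auto intro: summable_comparison_test'[of g 0])

lemma ell2_add:
  assumes "x \<in> ell2" "y \<in> ell2"
  shows "(\<lambda>n. x n + y n) \<in> ell2"
proof (rule ell2_dominated)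
  show "summable (\<lambda>n. 2 * (norm (x n))\<^sup>2 + 2 * (norm (y n))\<^sup>2)"
    using assms by (auto simp: ell2_def intro: summable_add)
  fix n
  have "(norm (x n + y n))\<^sup>2 \<le> (norm (x n) + norm (y n))\<^sup>2"
    by (intro power_mono norm_triangle_ineq) simp
  also have "\<dots> \<le> 2 * (norm (x n))\<^sup>2 + 2 * (norm (y n))\<^sup>2"
    using zero_le_power2[of "norm (x n) - norm (y n)"] unfolding power2_sum power2_diff by simp
  finally show "(norm (x n + y n))\<^sup>2 \<le> 2 * (norm (x n))\<^sup>2 + 2 * (norm (y n))\<^sup>2" .
qed

lemma ell2_bounded_mult:
  assumes "x \<in> ell2" "\<And>n. norm (c n) \<le> M"
  shows "(\<lambda>n. c n * x n) \<in> ell2"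
proof (rule ell2_dominated)
  show "summable (\<lambda>n. M\<^sup>2 * (norm (x n))\<^sup>2)" using assms by (auto simp: ell2_def)
  show "(norm (c n * x n))\<^sup>2 \<le> M\<^sup>2 * (norm (x n))\<^sup>2" for n
    unfolding norm_mult power_mult_distrib using assms(2) by (intro mult_right_mono power_mono) auto
qed

lemma ell2_scale: "x \<in> ell2 \<Longrightarrow> (\<lambda>n. c * x n) \<in> ell2"
  using ell2_bounded_mult[of x "\<lambda>_. c" "norm c"] by simp

lemma ell2_Suc_iff: "(\<lambda>n. x (Suc n)) \<in> ell2 \<longleftrightarrow> x \<in> ell2"
  unfolding ell2_def using summable_Suc_iff[of "\<lambda>n. (norm (x n))\<^sup>2"] by simp

lemma ell2_tendsto_0:
  assumes "x \<in> ell2"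
  shows "x \<longlonglongrightarrow> 0"
proof -
  have "(\<lambda>n. sqrt ((norm (x n))\<^sup>2)) \<longlonglongrightarrow> sqrt 0"
    using assms by (intro tendsto_real_sqrt summable_LIMSEQ_zero) (simp add: ell2_def)
  then show ?thesis by (simp add: tendsto_norm_zero_iff)
qed

lemma norm_le_ell2_norm:
  assumes "x \<in> ell2"
  shows "norm (x n) \<le> ell2_norm x"
proof -
  have "(norm (x n))\<^sup>2 \<le> (\<Sum>n. (norm (x n))\<^sup>2)"
    using sum_le_suminf[of "\<lambda>n. (norm (x n))\<^sup>2" "{n}"] assms by (simp add: ell2_def)
  then show ?thesis unfolding ell2_norm_def by (rule real_le_rsqrt)
qed

lemma ell2_bounded:
  assumes "x \<in> ell2"
  obtains M where "M > 0" "\<And>n. norm (x n) \<le> M"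
proof
  have "ell2_norm x \<ge> 0" using norm_le_ell2_norm[OF assms, of 0] norm_ge_zero order_trans by blast
  then show "ell2_norm x + 1 > 0" by simp
  show "norm (x n) \<le> ell2_norm x + 1" for n
    using norm_le_ell2_norm[OF assms, of n] by simp
qed

lemma unit_seq_ell2: "unit_seq i \<in> ell2"
proof -
  have "summable (\<lambda>n. (norm (unit_seq i n))\<^sup>2)"
    by (rule summable_finite[of "{i}"]) (auto simp: unit_seq_def)
  then show ?thesis by (simp add: ell2_def)
qed

lemma exp_decaying_imp_ell2:
  assumes "exp_decaying v"
  shows "v \<in> ell2"
proof -
  obtain C q where q: "0 < q" "q < (1::real)" and v: "\<And>n. norm (v n) \<le> C * q ^ n"
    using assms by (auto simp: exp_decaying_def)
  show ?thesis
  proof (rule ell2_dominated)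
    show "summable (\<lambda>n. C\<^sup>2 * (q\<^sup>2) ^ n)"
      using q by (intro summable_mult summable_geometric) (simp add: power_less_one_iff abs_square_less_1)
    show "(norm (v n))\<^sup>2 \<le> C\<^sup>2 * (q\<^sup>2) ^ n" for n
      using power_mono[OF v[of n], of 2] by (simp add: power_mult_distrib power_mult[symmetric] mult.commute)
  qed
qed

text \<open>Convexity of the square, applied to
  \<open>q * s + (1 - q) * (c / (1 - q))\<close>.\<close>

lemma square_convex_bound:
  fixes x s c q :: real
  assumes "0 \<le> x" "x \<le> q * s + c" "0 < q" "q < 1"
  shows "x\<^sup>2 \<le> q * s\<^sup>2 + c\<^sup>2 / (1 - q)"
proof -
  have "q * s\<^sup>2 + c\<^sup>2 / (1 - q) - (q * s + c)\<^sup>2 = q / (1 - q) * ((1 - q) * s - c)\<^sup>2"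
    using assms by (simp add: field_simps power2_eq_square)
  also have "\<dots> \<ge> 0" using assms by simp
  finally have "(q * s + c)\<^sup>2 \<le> q * s\<^sup>2 + c\<^sup>2 / (1 - q)" by simp
  moreover have "x\<^sup>2 \<le> (q * s + c)\<^sup>2" using assms by (intro power_mono) auto
  ultimately show ?thesis by simp
qed

text \<open>Summing the convexity bound returns \<open>q\<close> times the same partial sum, which
  is absorbed on the left since \<open>q < 1\<close>.\<close>

lemma square_summable_forward:
  fixes p c :: "nat \<Rightarrow> real"
  assumes p: "\<And>n. 0 \<le> p n" "\<And>n. p (Suc n) \<le> q * p n + c n" and q: "0 < q" "q < 1"
    and c: "summable (\<lambda>n. (c n)\<^sup>2)"
  shows "summable (\<lambda>n. (p n)\<^sup>2)"
proof (rule summableI_nonneg_bounded)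
  define D where "D = (\<Sum>n. (c n)\<^sup>2) / (1 - q)"
  show "(\<Sum>n<N. (p n)\<^sup>2) \<le> ((p 0)\<^sup>2 + D) / (1 - q)" for N
  proof -
    let ?S = "\<Sum>n<N. (p n)\<^sup>2"
    have "?S \<le> (\<Sum>n<Suc N. (p n)\<^sup>2)" by simp
    also have "\<dots> = (p 0)\<^sup>2 + (\<Sum>n<N. (p (Suc n))\<^sup>2)" by (rule sum.lessThan_Suc_shift)
    also have "(\<Sum>n<N. (p (Suc n))\<^sup>2) \<le> (\<Sum>n<N. q * (p n)\<^sup>2 + (c n)\<^sup>2 / (1 - q))"
      by (intro sum_mono square_convex_bound p q)
    also have "\<dots> = q * ?S + (\<Sum>n<N. (c n)\<^sup>2) / (1 - q)"
      by (simp add: sum.distrib sum_distrib_left sum_divide_distrib)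
    also have "(\<Sum>n<N. (c n)\<^sup>2) / (1 - q) \<le> D"
      unfolding D_def using c q by (intro divide_right_mono sum_le_suminf) auto
    finally have "?S * (1 - q) \<le> (p 0)\<^sup>2 + D" by (simp add: algebra_simps)
    then show ?thesis using q by (simp add: pos_le_divide_eq)
  qed
qed simp

text \<open>The estimate now runs downwards, so the partial sum picks up a term at its upper end;
  the a priori bound \<open>M\<close> controls it.\<close>

lemma square_summable_backward:
  fixes s c :: "nat \<Rightarrow> real"
  assumes s: "\<And>n. 0 \<le> s n" "\<And>n. s n \<le> q * s (Suc n) + c n" "\<And>n. s n \<le> M" and q: "0 < q" "q < 1"
    and c: "summable (\<lambda>n. (c n)\<^sup>2)"
  shows "summable (\<lambda>n. (s n)\<^sup>2)"
proof (rule summableI_nonneg_bounded)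
  define D where "D = (\<Sum>n. (c n)\<^sup>2) / (1 - q)"
  show "(\<Sum>n<N. (s n)\<^sup>2) \<le> (q * M\<^sup>2 + D) / (1 - q)" for N
  proof -
    let ?S = "\<Sum>n<N. (s n)\<^sup>2"
    have "?S \<le> (\<Sum>n<N. q * (s (Suc n))\<^sup>2 + (c n)\<^sup>2 / (1 - q))"
      by (intro sum_mono square_convex_bound s q)
    also have "\<dots> = q * (\<Sum>n<N. (s (Suc n))\<^sup>2) + (\<Sum>n<N. (c n)\<^sup>2) / (1 - q)"
      by (simp add: sum.distrib sum_distrib_left sum_divide_distrib)
    also have "(\<Sum>n<N. (c n)\<^sup>2) / (1 - q) \<le> D"
      unfolding D_def using c q by (intro divide_right_mono sum_le_suminf) auto
    also have "(\<Sum>n<N. (s (Suc n))\<^sup>2) \<le> ?S + M\<^sup>2"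
    proof -
      have "(s N)\<^sup>2 \<le> M\<^sup>2" using s by (intro power_mono) auto
      moreover have "(s 0)\<^sup>2 + (\<Sum>n<N. (s (Suc n))\<^sup>2) = ?S + (s N)\<^sup>2"
        using sum.lessThan_Suc_shift[of "\<lambda>n. (s n)\<^sup>2" N] by simp
      ultimately show ?thesis using zero_le_power2[of "s 0"] by linarith
    qed
    finally have "?S * (1 - q) \<le> q * M\<^sup>2 + D" using q by (simp add: algebra_simps)
    then show ?thesis using q by (simp add: pos_le_divide_eq)
  qed
qed simp

text \<open>With \<open>u\<close> growing at the rate at which \<open>v\<close> decays, the kernel of \<open>y \<mapsto> v S - u V\<close> decays
  exponentially away from the diagonal: as the full sum \<open>\<Sum>v y\<close> vanishes, \<open>V\<close> is minus a tail.\<close>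

lemma variation_of_constants_ell2:
  fixes v u y :: "nat \<Rightarrow> complex"
  assumes q: "0 < q" "q < 1" and v: "\<And>n. norm (v n) \<le> C * q ^ n" and u: "\<And>n. norm (u n) \<le> C / q ^ n"
    and y: "y \<in> ell2" and sums: "(\<lambda>n. v n * y n) sums 0"
  shows "(\<lambda>n. v n * (\<Sum>i\<le>n. u i * y i) - u n * (\<Sum>i\<le>n. v i * y i)) \<in> ell2"
proof -
  define S V where "S = (\<lambda>n. \<Sum>i\<le>n. u i * y i)" and "V = (\<lambda>n. \<Sum>i\<le>n. v i * y i)"
  have "norm (v 0) \<le> C" using v[of 0] by simp
  then have C: "C \<ge> 0" using norm_ge_zero order_trans by blast
  \<comment> \<open>Rescaled by the decay rate, both sums contract by the factor \<open>q\<close>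
    per step: \<open>p\<close> going upwards, \<open>s\<close> going downwards.\<close>
  define p s where "p = (\<lambda>n. q ^ n * norm (S n))" and "s = (\<lambda>n. norm (V n) / q ^ n)"
  have c: "summable (\<lambda>n. (C * norm (y (Suc n)))\<^sup>2)"
    using y ell2_Suc_iff[of y] by (simp add: power_mult_distrib ell2_def)
  have "summable (\<lambda>n. (p n)\<^sup>2)"
  proof (rule square_summable_forward[OF _ _ q c])
    show "0 \<le> p n" for n using q by (simp add: p_def)
    show "p (Suc n) \<le> q * p n + C * norm (y (Suc n))" for n
    proof -
      have "norm (u (Suc n) * y (Suc n)) \<le> C / q ^ Suc n * norm (y (Suc n))"
        unfolding norm_mult by (intro mult_right_mono u) auto
      then have "norm (S (Suc n)) \<le> norm (S n) + C / q ^ Suc n * norm (y (Suc n))"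
        using norm_triangle_ineq[of "S n" "u (Suc n) * y (Suc n)"] by (simp add: S_def)
      then have "p (Suc n) \<le> q ^ Suc n * (norm (S n) + C / q ^ Suc n * norm (y (Suc n)))"
        unfolding p_def using q by (intro mult_left_mono) auto
      also have "\<dots> = q * p n + C * norm (y (Suc n))"
        using q by (simp add: p_def field_simps)
      finally show ?thesis .
    qed
  qed
  moreover have "summable (\<lambda>n. (s n)\<^sup>2)"
  proof -
    obtain Y where Y: "Y > 0" "\<And>n. norm (y n) \<le> Y" using ell2_bounded[OF y] by blast
    show ?thesis
    proof (rule square_summable_backward[OF _ _ _ q c])
      show "0 \<le> s n" for n using q by (simp add: s_def)
      show "s n \<le> q * s (Suc n) + C * norm (y (Suc n))" for n
      proof -
        have "V n = V (Suc n) - v (Suc n) * y (Suc n)" by (simp add: V_def)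
        then have "norm (V n) \<le> norm (V (Suc n)) + norm (v (Suc n) * y (Suc n))"
          by (metis norm_triangle_ineq4)
        also have "norm (v (Suc n) * y (Suc n)) \<le> C * q ^ Suc n * norm (y (Suc n))"
          unfolding norm_mult by (intro mult_right_mono v) auto
        finally have "s n \<le> (norm (V (Suc n)) + C * q ^ Suc n * norm (y (Suc n))) / q ^ n"
          unfolding s_def using q by (intro divide_right_mono) auto
        also have "\<dots> = q * s (Suc n) + q * (C * norm (y (Suc n)))"
          using q by (simp add: s_def field_simps)
        also have "q * (C * norm (y (Suc n))) \<le> 1 * (C * norm (y (Suc n)))"
          using q C by (intro mult_right_mono) auto
        finally show ?thesis by simp
      qed
      show "s n \<le> C * Y * q / (1 - q)" for n
      proof -
        have "(\<lambda>i. v (i + Suc n) * y (i + Suc n)) sums (0 - (\<Sum>i<Suc n. v i * y i))"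
          using sums_split_initial_segment[OF sums] .
        then have tail: "V n = - (\<Sum>i. v (i + Suc n) * y (i + Suc n))"
          by (simp add: V_def lessThan_Suc_atMost sums_iff)
        have geo: "(\<lambda>i. C * Y * q ^ Suc n * q ^ i) sums (C * Y * q ^ Suc n * (1 / (1 - q)))"
          using q by (intro sums_mult geometric_sums) auto
        have "norm (V n) \<le> (\<Sum>i. C * Y * q ^ Suc n * q ^ i)"
          unfolding tail norm_minus_cancel
        proof (rule norm_suminf_le)
          show "summable (\<lambda>i. C * Y * q ^ Suc n * q ^ i)" using geo by (rule sums_summable)
          fix i
          have "norm (v (i + Suc n)) * norm (y (i + Suc n)) \<le> C * q ^ (i + Suc n) * Y"
            using q C by (intro mult_mono v Y) auto
          then show "norm (v (i + Suc n) * y (i + Suc n)) \<le> C * Y * q ^ Suc n * q ^ i"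
            by (simp add: norm_mult power_add mult_ac)
        qed
        also have "\<dots> = C * Y * q / (1 - q) * q ^ n"
          using sums_unique[OF geo] by simp
        finally show ?thesis unfolding s_def using q by (simp add: pos_divide_le_eq)
      qed
    qed
  qed
  ultimately have "summable (\<lambda>n. 2 * C\<^sup>2 * (p n)\<^sup>2 + 2 * C\<^sup>2 * (s n)\<^sup>2)"
    by (intro summable_add summable_mult)
  moreover have "(norm (v n * S n - u n * V n))\<^sup>2 \<le> 2 * C\<^sup>2 * (p n)\<^sup>2 + 2 * C\<^sup>2 * (s n)\<^sup>2" for n
  proof -
    have "norm (v n * S n) \<le> C * q ^ n * norm (S n)" "norm (u n * V n) \<le> C / q ^ n * norm (V n)"
      unfolding norm_mult by (intro mult_right_mono u v norm_ge_zero)+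
    then have "norm (v n * S n - u n * V n) \<le> C * p n + C * s n"
      using norm_triangle_ineq4[of "v n * S n" "u n * V n"] by (simp add: p_def s_def)
    then have "(norm (v n * S n - u n * V n))\<^sup>2 \<le> (C * p n + C * s n)\<^sup>2"
      by (intro power_mono) auto
    also have "\<dots> \<le> 2 * C\<^sup>2 * (p n)\<^sup>2 + 2 * C\<^sup>2 * (s n)\<^sup>2"
      using zero_le_power2[of "C * p n - C * s n"] unfolding power2_sum power2_diff
      by (simp add: power_mult_distrib)
    finally show ?thesis .
  qed
  ultimately have "(\<lambda>n. v n * S n - u n * V n) \<in> ell2" by (rule ell2_dominated)
  then show ?thesis by (simp only: S_def V_def)
qed

section \<open>Kernel and range of the operator minus \<open>lam\<close>\<close>

context tridiagonal_toeplitz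
begin

text \<open>The quotient \<open>norm (w n) / r ^ n\<close> is \<open>k\<close>-periodic, so its
  values over one period bound it.\<close>

lemma quasi_periodic_bound:
  fixes w :: "nat \<Rightarrow> complex"
  assumes per: "\<And>n. w (n + k) = \<rho> * w n" and r: "r > 0" "r ^ k = norm \<rho>"
  obtains C where "\<And>n. norm (w n) \<le> C * r ^ n"
proof -
  have "norm (w n) \<le> (\<Sum>i<k. norm (w i) / r ^ i) * r ^ n" for n
  proof -
    have "norm (w (l + m * k)) = norm (w l) / r ^ l * r ^ (l + m * k)" for l m
      unfolding period_power[of w \<rho>, OF per] norm_mult norm_power r(2)[symmetric]
      using r(1) by (simp add: power_add power_mult[symmetric] mult.commute)
    from this[of "n mod k" "n div k"]
    have "norm (w n) = norm (w (n mod k)) / r ^ (n mod k) * r ^ n" by simp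
    also have "\<dots> \<le> (\<Sum>i<k. norm (w i) / r ^ i) * r ^ n"
      using r(1) k_pos
      by (intro mult_right_mono member_le_sum[where i = "n mod k" and f = "\<lambda>i. norm (w i) / r ^ i"]) auto
    finally show ?thesis .
  qed
  with that show ?thesis by blast
qed

lemma row_ell2:
  assumes "x \<in> ell2"
  shows "local.row x \<in> ell2"
proof -
  obtain M where M: "\<forall>n. norm (B n) \<le> M \<and> norm (A n) \<le> M" using coefficients_bounded by blast
  have "(\<lambda>n. B n * x n + (A (Suc n) * x (Suc n) + B (Suc n) * x (Suc (Suc n)))) \<in> ell2"
    using assms M by (intro ell2_add ell2_bounded_mult[where M = M]) (auto simp: ell2_Suc_iff[of x] ell2_Suc_iff[of "\<lambda>n. x (Suc n)"])
  then have "(\<lambda>n. local.row x (Suc n)) \<in> ell2" by (simp add: row_Suc add.assoc)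
  then show ?thesis by (simp add: ell2_Suc_iff)
qed

text \<open>The rate per step is the \<open>k\<close>-th root of the modulus of the multiplier per
  period. One constant and one rate serve both sequences, as variation of constants
  requires.\<close>

lemma bloch_bounds:
  assumes bloch: "bloch \<mu> v" and \<mu>: "norm \<mu> < 1" and u: "\<And>n. u (n + k) = 1 / \<mu> * u n"
  obtains C q where "0 < q" "q < (1::real)" "\<And>n. norm (v n) \<le> C * q ^ n" "\<And>n. norm (u n) \<le> C / q ^ n"
proof -
  define q where "q = root k (norm \<mu>)"
  have \<mu>0: "\<mu> \<noteq> 0" and per: "\<And>n. v (n + k) = \<mu> * v n" using bloch by (auto simp: bloch_def)
  have k0: "k > 0" using k_pos by simp
  have q: "0 < q" "q < 1" "q ^ k = norm \<mu>"
    using k0 \<mu> \<mu>0 by (auto simp: q_def real_root_pow_pos2)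
  have "(1 / q) ^ k = norm (1 / \<mu>)" using q(3) by (simp add: power_one_over norm_divide)
  then obtain D where D: "\<And>n. norm (u n) \<le> D * (1 / q) ^ n"
    using quasi_periodic_bound[of u "1 / \<mu>" "1 / q", OF u] q(1) by auto
  obtain C where C: "\<And>n. norm (v n) \<le> C * q ^ n"
    using quasi_periodic_bound[of v \<mu> q, OF per q(1,3)] by blast
  have "norm (v n) \<le> max C D * q ^ n" for n
    by (rule order_trans[OF C]) (use q in \<open>auto intro: mult_right_mono\<close>)
  moreover have "norm (u n) \<le> max C D / q ^ n" for n
    by (rule order_trans[OF D]) (use q in \<open>auto simp: power_one_over power_inverse divide_inverse intro: mult_right_mono\<close>)
  ultimately show ?thesis using that q by blast
qed

text \<open>The zero sequence serves as the second quasi-periodic sequence.\<close>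

lemma bloch_exp_decaying:
  assumes "bloch \<mu> v" "norm \<mu> < 1"
  shows "exp_decaying v"
  using bloch_bounds[OF assms, of "\<lambda>_. 0"] unfolding exp_decaying_def by (metis mult_zero_right)

text \<open>With both sums frozen the row vanishes, since \<open>v\<close> and \<open>u\<close>
  solve it. The right neighbour's new terms cancel, and the left neighbour's missing terms produce
  the Wronskian. In row \<open>0\<close> the sequence itself vanishes, so no boundary condition on
  \<open>u\<close> is involved.\<close>

lemma row_variation_of_constants:
  fixes v u y :: "nat \<Rightarrow> complex"
  assumes v: "\<And>n. local.row v n = 0" and u: "\<And>n. local.row u (Suc n) = 0"
  shows "local.row (\<lambda>n. v n * (\<Sum>i\<le>n. u i * y i) - u n * (\<Sum>i\<le>n. v i * y i)) n
    = - wronskian v u 0 * y n"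
proof (cases n)
  case 0
  then show ?thesis by (simp add: row_0 wronskian_def algebra_simps)
next
  case (Suc m)
  define S V where "S = (\<Sum>i\<le>Suc m. u i * y i)" and "V = (\<Sum>i\<le>Suc m. v i * y i)"
  have S: "(\<Sum>i\<le>m. u i * y i) = S - u (Suc m) * y (Suc m)"
    "(\<Sum>i\<le>Suc (Suc m). u i * y i) = S + u (Suc (Suc m)) * y (Suc (Suc m))"
    by (simp_all add: S_def)
  have V: "(\<Sum>i\<le>m. v i * y i) = V - v (Suc m) * y (Suc m)"
    "(\<Sum>i\<le>Suc (Suc m). v i * y i) = V + v (Suc (Suc m)) * y (Suc (Suc m))"
    by (simp_all add: V_def)
  have "local.row (\<lambda>n. v n * (\<Sum>i\<le>n. u i * y i) - u n * (\<Sum>i\<le>n. v i * y i)) (Suc m)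
    = S * local.row v (Suc m) - V * local.row u (Suc m) - wronskian v u m * y (Suc m)"
    unfolding row_Suc S V S_def[symmetric] V_def[symmetric] wronskian_def
    by (simp add: algebra_simps)
  also have "\<dots> = - wronskian v u 0 * y (Suc m)"
    using v u wronskian_const[of v u m] by simp
  finally show ?thesis using Suc by simp
qed

lemma bloch_range:
  assumes bloch: "bloch \<mu> v" and \<mu>: "norm \<mu> < 1"
  shows "local.row ` ell2 = {y \<in> ell2. (\<lambda>n. v n * y n) sums 0}"
proof (intro equalityI subsetI)
  from bloch have v0: "v 0 \<noteq> 0" and \<mu>0: "\<mu> \<noteq> 0" and per: "\<And>n. v (n + k) = \<mu> * v n"
    and row: "\<And>n. local.row v n = 0"
    by (auto simp: bloch_def)
  have v_lim: "v \<longlonglongrightarrow> 0"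
    by (intro ell2_tendsto_0 exp_decaying_imp_ell2 bloch_exp_decaying[OF assms])
  {
    fix y assume "y \<in> local.row ` ell2"
    then obtain x where x: "x \<in> ell2" "y = local.row x" by blast
    \<comment> \<open>By the Green identity these partial sums are Wronskians of two null
      sequences.\<close>
    have "(\<lambda>n. \<Sum>i\<le>n. v i * y i) \<longlonglongrightarrow> 0"
      using green_identity[of v x] wronskian_tendsto_0[OF v_lim ell2_tendsto_0[OF x(1)]]
      by (simp add: x(2) row fun_eq_iff)
    then show "y \<in> {y \<in> ell2. (\<lambda>n. v n * y n) sums 0}"
      using x row_ell2 by (simp add: sums_def_le)
  next
    fix y assume y: "y \<in> {y \<in> ell2. (\<lambda>n. v n * y n) sums 0}"
    obtain u where u: "\<And>n. u (n + k) = 1 / \<mu> * u n" "\<And>n. local.row u (Suc n) = 0" "u \<noteq> (\<lambda>_. 0)"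
      using bloch_dual_solution[OF bloch] by blast
    define \<omega> where "\<omega> = wronskian v u 0"
    \<comment> \<open>Proportional sequences have equal multipliers, but \<mu> and 1/\<mu>
      differ.\<close>
    have "\<omega> \<noteq> 0"
    proof
      assume "\<omega> = 0"
      then have proportional: "u n = u 0 / v 0 * v n" for n
        unfolding \<omega>_def by (intro wronskian_zero_proportional[OF row u(2) _ v0])
      have "1 / \<mu> * u 0 = \<mu> * u 0"
      proof -
        have "1 / \<mu> * u 0 = u k" using u(1)[of 0] by simp
        also have "\<dots> = u 0 / v 0 * v k" by (rule proportional)
        also have "v k = \<mu> * v 0" using per[of 0] by simp
        finally show ?thesis using v0 by simp
      qed
      then have "u 0 = \<mu>\<^sup>2 * u 0" using \<mu>0 by (simp add: field_simps power2_eq_square)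
      moreover have "\<mu>\<^sup>2 \<noteq> 1"
      proof
        assume "\<mu>\<^sup>2 = 1"
        then have "norm \<mu> ^ 2 = 1" by (metis norm_power norm_one)
        with \<mu> show False by (simp add: abs_square_eq_1)
      qed
      ultimately have "u 0 = 0" by auto
      then have "u n = 0" for n using proportional[of n] by simp
      with u(3) show False by auto
    qed
    obtain C q where "0 < q" "q < (1::real)" "\<And>n. norm (v n) \<le> C * q ^ n" "\<And>n. norm (u n) \<le> C / q ^ n"
      by (rule bloch_bounds[OF assms, of u, OF u(1)]) blast
    then have x: "(\<lambda>n. v n * (\<Sum>i\<le>n. u i * y i) - u n * (\<Sum>i\<le>n. v i * y i)) \<in> ell2" (is "?x \<in> ell2")
      using y by (intro variation_of_constants_ell2) auto
    have "local.row (\<lambda>n. - 1 / \<omega> * ?x n) n = y n" for n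
      unfolding row_scale row_variation_of_constants[of v u, OF row u(2)] \<omega>_def[symmetric]
      using \<open>\<omega> \<noteq> 0\<close> by simp
    then have "y = local.row (\<lambda>n. - 1 / \<omega> * ?x n)" by auto
    then show "y \<in> local.row ` ell2" using ell2_scale[OF x] by blast
  }
qed

lemma bloch_fredholm:
  assumes bloch: "bloch \<mu> v" and \<mu>: "norm \<mu> < 1"
  shows "fredholm (op_minus_scalar (tridiag_op k a b) lam)"
proof -
  from bloch have v0: "v 0 \<noteq> 0" and row: "\<And>n. local.row v n = 0"
    by (auto simp: bloch_def)
  have op: "op_minus_scalar (tridiag_op k a b) lam = local.row"
    by (simp add: fun_eq_iff tridiag_op_row)
  have v: "v \<in> ell2" "exp_decaying v"
    using bloch_exp_decaying[OF assms] exp_decaying_imp_ell2 by auto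
  have "op_kernel local.row \<subseteq> lin_span {v}"
  proof
    fix x assume "x \<in> op_kernel local.row"
    then have x: "local.row x n = 0" for n by (simp add: op_kernel_def)
    \<comment> \<open>Both sequences meet the boundary condition, which fixes the ratio of the first
      two entries.\<close>
    have "wronskian v x 0 = 0" using x row by (simp add: wronskian_0)
    then have "\<forall>n. x n = x 0 / v 0 * v n"
      using wronskian_zero_proportional[OF row x _ v0] by blast
    then obtain c where "x = (\<lambda>n. c * v n)" by blast
    then show "x \<in> lin_span {v}"
      unfolding lin_span_def by (intro CollectI exI[of _ "{v}"] exI[of _ "\<lambda>_. c"]) simp
  qed
  moreover have "closed_in_ell2 (local.row ` ell2)"
    unfolding closed_in_ell2_def
  proof (intro allI ballI impI)
    fix X y assume y: "y \<in> ell2"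
      and "(\<forall>j. X j \<in> local.row ` ell2) \<and> (\<lambda>j. ell2_norm (\<lambda>n. X j n - y n)) \<longlonglongrightarrow> 0"
    then have lim: "(\<lambda>j. ell2_norm (\<lambda>n. X j n - y n)) \<longlonglongrightarrow> 0"
      and "\<forall>j. X j \<in> ell2 \<and> (\<lambda>n. v n * X j n) sums 0"
      unfolding bloch_range[OF assms] by auto
    then have X: "X j \<in> ell2" "(\<lambda>n. v n * X j n) sums 0" for j by blast+
    obtain C q where q: "0 < q" "q < (1::real)" "\<And>n. norm (v n) \<le> C * q ^ n"
      using v(2) by (auto simp: exp_decaying_def)
    have sv: "summable (\<lambda>n. norm (v n))"
      by (rule summable_comparison_test'[of "\<lambda>n. C * q ^ n" 0]) (use q in \<open>auto intro: summable_geometric\<close>)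
    \<comment> \<open>The functional defining the hyperplane is bounded: \<open>v\<close> is
      absolutely summable, and the supremum norm is at most the \<open>ell2\<close> norm. Hence the
      hyperplane is closed.\<close>
    have bound: "summable (\<lambda>n. v n * z n) \<and> norm (\<Sum>n. v n * z n) \<le> (\<Sum>n. norm (v n)) * ell2_norm z"
      if "z \<in> ell2" for z
    proof -
      have *: "norm (v n * z n) \<le> norm (v n) * ell2_norm z" for n
        unfolding norm_mult by (intro mult_left_mono norm_le_ell2_norm that) simp
      have **: "summable (\<lambda>n. norm (v n) * ell2_norm z)" by (intro summable_mult2 sv)
      have "norm (\<Sum>n. v n * z n) \<le> (\<Sum>n. norm (v n) * ell2_norm z)"
        by (rule norm_suminf_le[OF * **])
      then show ?thesis
        using summable_comparison_test'[OF **, of 0 "\<lambda>n. v n * z n"] * by (simp add: suminf_mult2[OF sv])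
    qed
    have "norm (\<Sum>n. v n * y n) \<le> (\<Sum>n. norm (v n)) * ell2_norm (\<lambda>n. X j n - y n)" for j
    proof -
      have "(\<lambda>n. X j n - y n) \<in> ell2"
        using ell2_add[OF X(1)[of j] ell2_scale[OF y, of "- 1"]] by simp
      from bound[OF this] have b: "norm (\<Sum>n. v n * (X j n - y n)) \<le> (\<Sum>n. norm (v n)) * ell2_norm (\<lambda>n. X j n - y n)"
        by blast
      have "(\<lambda>n. v n * X j n - v n * y n) sums (0 - (\<Sum>n. v n * y n))"
        using bound[OF y] by (intro sums_diff X(2) summable_sums) blast
      then have "(\<Sum>n. v n * (X j n - y n)) = - (\<Sum>n. v n * y n)"
        by (simp add: sums_iff right_diff_distrib)
      with b show ?thesis by simp
    qed
    moreover have "(\<lambda>j. (\<Sum>n. norm (v n)) * ell2_norm (\<lambda>n. X j n - y n)) \<longlonglongrightarrow> (\<Sum>n. norm (v n)) * 0"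
      by (intro tendsto_mult tendsto_const lim)
    ultimately have "norm (\<Sum>n. v n * y n) \<le> (\<Sum>n. norm (v n)) * 0"
      by (intro LIMSEQ_le_const) auto
    then have "(\<lambda>n. v n * y n) sums 0"
      using bound[OF y] by (simp add: sums_iff)
    then show "y \<in> local.row ` ell2" unfolding bloch_range[OF assms] using y by simp
  qed
  \<comment> \<open>As \<open>v 0 \<noteq> 0\<close>, the first unit sequence complements the
    hyperplane; \<open>c\<close> below is the multiple that corrects \<open>y\<close>.\<close>
  moreover have "\<exists>x\<in>ell2. \<exists>w\<in>lin_span {unit_seq 0}. y = (\<lambda>n. local.row x n + w n)" if y: "y \<in> ell2" for y
  proof -
    have "summable (\<lambda>n. norm (v n * y n))"
    proof (rule summable_comparison_test'[of "\<lambda>n. ((norm (v n))\<^sup>2 + (norm (y n))\<^sup>2) / 2" 0])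
      show "summable (\<lambda>n. ((norm (v n))\<^sup>2 + (norm (y n))\<^sup>2) / 2)"
        using v y by (intro summable_divide summable_add) (simp_all add: ell2_def)
      show "norm (norm (v n * y n)) \<le> ((norm (v n))\<^sup>2 + (norm (y n))\<^sup>2) / 2" for n
        using zero_le_power2[of "norm (v n) - norm (y n)"] unfolding power2_diff
        by (simp add: norm_mult)
    qed
    then have s: "(\<lambda>n. v n * y n) sums (\<Sum>n. v n * y n)"
      by (rule summable_sums[OF summable_norm_cancel])
    define c where "c = (\<Sum>n. v n * y n) / v 0"
    define w where "w = (\<lambda>n. c * unit_seq 0 n)"
    have "(\<lambda>n. v n * w n) sums (\<Sum>n\<in>{0}. v n * w n)"
      by (rule sums_finite) (auto simp: w_def unit_seq_def)
    then have "(\<lambda>n. v n * w n) sums (\<Sum>n. v n * y n)"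
      using v0 by (simp add: w_def c_def unit_seq_def)
    from sums_diff[OF s this] have "(\<lambda>n. v n * (y n - w n)) sums 0"
      by (simp add: right_diff_distrib)
    moreover have "(\<lambda>n. y n - w n) \<in> ell2"
      using ell2_add[OF y ell2_scale[OF unit_seq_ell2, of "- c" 0]] by (simp add: w_def)
    ultimately have "(\<lambda>n. y n - w n) \<in> local.row ` ell2"
      unfolding bloch_range[OF assms] by simp
    then obtain x where x: "x \<in> ell2" "(\<lambda>n. y n - w n) = local.row x" by blast
    have "w \<in> lin_span {unit_seq 0}"
      unfolding lin_span_def
      by (intro CollectI exI[of _ "{unit_seq 0}"] exI[of _ "\<lambda>_. c"]) (simp add: w_def)
    moreover have "y = (\<lambda>n. local.row x n + w n)" by (simp add: x(2)[symmetric])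
    ultimately show ?thesis using x(1) by blast
  qed
  moreover have "finite {v}" "{v} \<subseteq> ell2" "finite {unit_seq 0}" "{unit_seq 0} \<subseteq> ell2"
    using v(1) unit_seq_ell2 by auto
  ultimately show ?thesis
    unfolding fredholm_def op by meson
qed

lemma edge_eigenvalue_iff_bloch:
  "edge_eigenvalue (tridiag_op k a b) lam \<longleftrightarrow> (\<exists>\<mu> v. bloch \<mu> v \<and> norm \<mu> < 1)"
proof
  assume "edge_eigenvalue (tridiag_op k a b) lam"
  then obtain v where v: "v \<noteq> (\<lambda>n. 0)" "exp_decaying v" "\<forall>n. local.row v n = 0"
    by (auto simp: edge_eigenvalue_def tridiag_op_eigen_iff)
  then obtain \<mu> where "bloch \<mu> v" "norm \<mu> < 1"
    using bloch_if_null_sequence[OF _ v(1) ell2_tendsto_0[OF exp_decaying_imp_ell2[OF v(2)]]] by auto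
  then show "\<exists>\<mu> v. bloch \<mu> v \<and> norm \<mu> < 1" by blast
next
  assume "\<exists>\<mu> v. bloch \<mu> v \<and> norm \<mu> < 1"
  then obtain \<mu> v where v: "bloch \<mu> v" "norm \<mu> < 1" by blast
  note dec = bloch_exp_decaying[OF v]
  have "v \<noteq> (\<lambda>n. 0)" "tridiag_op k a b v = (\<lambda>n. lam * v n)"
    using v(1) by (auto simp: bloch_def tridiag_op_eigen_iff)
  then show "edge_eigenvalue (tridiag_op k a b) lam"
    unfolding edge_eigenvalue_def ess_spectrum_def
    using bloch_fredholm[OF v] dec exp_decaying_imp_ell2[OF dec] by blast
qed

end

section \<open>Characterization of the edge eigenvalues\<close>

theorem theorem2p8:
  fixes k :: nat and a b :: "nat \<Rightarrow> complex" and lam :: complex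
  assumes "k \<ge> 1"
    and "\<And>i. i < k \<Longrightarrow> b i \<noteq> 0"
  shows "edge_eigenvalue (tridiag_op k a b) lam \<longleftrightarrow>
    lam \<in> G_zero k a b \<inter> spectrum (B_zero k a b)"
proof -
  interpret tridiagonal_toeplitz k a b lam
    by unfold_locales (use assms in auto)
  show ?thesis
  proof
    assume "edge_eigenvalue (tridiag_op k a b) lam"
    then obtain \<mu> v where v: "bloch \<mu> v" and \<mu>: "norm \<mu> < 1"
      unfolding edge_eigenvalue_iff_bloch by blast
    then show "lam \<in> G_zero k a b \<inter> spectrum (B_zero k a b)"
      using bloch_Gamma_iff[OF v] bloch_C_zero[OF v] bloch_imp_spectrum[OF v]
      by (simp add: G_zero_def)
  next
    assume "lam \<in> G_zero k a b \<inter> spectrum (B_zero k a b)"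
    then have G: "lam \<notin> Gamma_set k a b" "C_zero k a b lam = 0" and "lam \<in> spectrum (B_zero k a b)"
      by (auto simp: G_zero_def)
    then obtain \<mu> v where v: "bloch \<mu> v" using spectrum_imp_bloch by blast
    \<comment> \<open>Off \<open>Gamma_set\<close> the value of \<open>C_zero\<close> is
      \<open>0\<close> or \<open>1\<close>, and its vanishing singles out the decaying
      solutions.\<close>
    then have "norm \<mu> \<noteq> 1" "norm \<mu> < 1"
      using G bloch_Gamma_iff[OF v] bloch_C_zero[OF v] by (auto split: if_splits)
    with v show "edge_eigenvalue (tridiag_op k a b) lam"
      unfolding edge_eigenvalue_iff_bloch by blast
  qed
qed

end
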